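(* Consider the setting and algorithm described in the context. Let $\gamma>0$ and $K_0\ge0$ be such that for all $k\ge K_0$: $\gamma_k=\gamma$, $\delta_k=\delta:=2\nu+L_{\nabla h}+\frac{2\|A\|^2}{\gamma}$ and $\|z^{k+1}\|\le\min\left(\frac{\varepsilon}{\gamma},\sqrt{\frac{2\varepsilon}{\gamma}}\right)$. Let $0<m\le M$ be constants with $m<f(Kx^k)\le M$ for all $k\ge1$, and let $K_1\ge K_0+1$ be such that $m\le\langle Kx^k,y^k\rangle-f^*(y^k)\le f(Kx^k)\le M$ for all $k\ge K_1$. Let $\Pi:\mathbb{R}^n\times\operatorname{dom}g^*\times\mathbb{R}^n\to\mathbb{R}\cup\{+\infty\}$, $\Pi(x,z,u):=\Psi(x,z,u,\delta,\gamma)/f(Kx)$. Suppose that $f$ is differentiable with Lipschitz continuous gradient on an open set containing $K(\mathcal{S})$ and that $g$ is essentially strictly convex. Then there exists $\zeta>0$ such that for all $k\ge K_1$, $\operatorname{dist}\big(0,\partial\Pi(x^{k+1},z^{k+1},u^{k+1})\big)\le\zeta\big(\|x^k-x^{k+1}\|+\|u^k-u^{k+1}\|+\|z^k-z^{k+1}\|\big)$, where $\partial$ denotes the limiting subdifferential.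
   Context: Setting: $\mathcal{S}\subseteq\mathbb{R}^n$ nonempty, convex, compact; $A:\mathbb{R}^n\to\mathbb{R}^s$, $K:\mathbb{R}^n\to\mathbb{R}^p$ linear with adjoints $A^*,K^*$ and operator norm $\|A\|$; $g:\mathbb{R}^s\to\mathbb{R}\cup\{+\infty\}$ proper, convex, lsc; $h:\mathbb{R}^n\to\mathbb{R}$ differentiable on an open set containing $\mathcal{S}$ with $L_{\nabla h}$-Lipschitz gradient there; $f:\mathbb{R}^p\to\mathbb{R}\cup\{+\infty\}$ proper, convex, lsc with $K(\mathcal{S})\subseteq\operatorname{int}(\operatorname{dom}f)$ and $f(Kx)>0$ on $\mathcal{S}$; $\mathcal{S}\cap A^{-1}(\operatorname{dom}g)\ne\emptyset$, $\inf_{x\in\mathcal{S}}\{g(Ax)+h(x)\}>0$; $A(\mathcal{S})\subseteq\operatorname{dom}(\partial g)$ and there is $\ell>0$ with $\operatorname{dist}(0,\partial g(Ax))\le\ell$ for all $x\in\mathcal{S}$. Notation: $f^*,g^*$ Fenchel conjugates; $\iota_{\mathcal{S}}$ indicator; $\operatorname{Proj}_{\mathcal{S}}$ projection; $\operatorname{prox}_{\varphi,\kappa}(x)=\arg\min_y\{\varphi(y)+\frac1{2\kappa}\|y-x\|^2\}$; $\Psi(x,z,u,\delta,\gamma):=\langle z,Ax\rangle-g^*(z)+h(x)+\iota_{\mathcal{S}}(x)+\frac{\delta}{2}\|x-u\|^2-\frac{\gamma}{2}\|z\|^2$. A proper function is essentially strictly convex if it is strictly convex on every convex subset of the domain of its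 subdifferential. Algorithm: given $0<\beta<2$, $\nu>0$, $0<q<1$, $\delta_0,\theta_0>0$, $\gamma_0=1$, $\varepsilon>0$ and $(x^0,z^0,u^0)$, for $k\ge0$: choose $y^{k+1}\in\partial f(Kx^k)$; $x^{k+1}:=\operatorname{Proj}_{\mathcal{S}}(u^k+\frac{\theta_k}{\delta_k}K^*y^{k+1}-\frac1{\delta_k}\nabla h(x^k)-\frac1{\delta_k}A^*z^k)$; $u^{k+1}:=(1-\beta)u^k+\beta x^{k+1}$; take the smallest $j_k\ge0$ such that with $\gamma_{k,j_k}:=\gamma_kq^{j_k}$, $z^{k+1,j_k}:=\operatorname{prox}_{g^*,1/\gamma_{k,j_k}}(Ax^{k+1}/\gamma_{k,j_k})$ one has $\theta_{k+1}:=\Psi(x^{k+1},z^{k+1,j_k},u^{k+1},\delta_k,\gamma_{k,j_k})/f(Kx^{k+1})>0$; set $\gamma_{k+1}:=\gamma_{k,j_k}$, $\delta_{k+1}:=2\nu+L_{\nabla h}+2\|A\|^2/\gamma_{k+1}$, $z^{k+1}:=z^{k+1,j_k}$; if $\|z^{k+1}\|>\min(\varepsilon/\gamma_{k+1},\sqrt{2\varepsilon/\gamma_{k+1}})$, replace $\gamma_{k+1}$ by $\gamma_{k+1}q$ and recompute $\delta_{k+1}$ by the same formula. *)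

theory Defs
  imports "HOL-Analysis.Analysis"
begin

definition eproper :: "('a \<Rightarrow> ereal) \<Rightarrow> bool" where
  "eproper F \<longleftrightarrow> (\<forall>x. F x \<noteq> -\<infinity>) \<and> (\<exists>x. F x \<noteq> \<infinity>)"

definition econvex :: "('a::real_vector \<Rightarrow> ereal) \<Rightarrow> bool" where
  "econvex F \<longleftrightarrow> convex {(x, r::real). F x \<le> ereal r}"

definition elsc :: "('a::topological_space \<Rightarrow> ereal) \<Rightarrow> bool" where
  "elsc F \<longleftrightarrow> closed {(x, r::real). F x \<le> ereal r}"

definition edom :: "('a \<Rightarrow> ereal) \<Rightarrow> 'a set" where
  "edom F = {x. F x < \<infinity>}"

definition fconj :: "('a::real_inner \<Rightarrow> ereal) \<Rightarrow> 'a \<Rightarrow> ereal" where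
  "fconj F y = (SUP x. ereal (x \<bullet> y) - F x)"

definition csubdiff :: "('a::real_inner \<Rightarrow> ereal) \<Rightarrow> 'a \<Rightarrow> 'a set" where
  "csubdiff F x = {v. \<bar>F x\<bar> \<noteq> \<infinity> \<and> (\<forall>y. F x + ereal (v \<bullet> (y - x)) \<le> F y)}"

definition estrictly_convex_on :: "('a::real_vector \<Rightarrow> ereal) \<Rightarrow> 'a set \<Rightarrow> bool" where
  "estrictly_convex_on F C \<longleftrightarrow>
     (\<forall>x\<in>C. \<forall>y\<in>C. \<forall>t. x \<noteq> y \<and> 0 < t \<and> t < 1 \<longrightarrow>
        F ((1 - t) *\<^sub>R x + t *\<^sub>R y) < ereal (1 - t) * F x + ereal t * F y)"

definition ess_strictly_convex :: "('a::real_inner \<Rightarrow> ereal) \<Rightarrow> bool" where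
  "ess_strictly_convex F \<longleftrightarrow>
     (\<forall>C. convex C \<and> C \<subseteq> {x. csubdiff F x \<noteq> {}} \<longrightarrow> estrictly_convex_on F C)"

definition prox :: "('a::real_normed_vector \<Rightarrow> ereal) \<Rightarrow> real \<Rightarrow> 'a \<Rightarrow> 'a" where
  "prox \<phi> \<kappa> x = (THE p. \<forall>w. \<phi> p + ereal ((norm (p - x))\<^sup>2 / (2 * \<kappa>))
                              \<le> \<phi> w + ereal ((norm (w - x))\<^sup>2 / (2 * \<kappa>)))"

definition indic :: "'a set \<Rightarrow> 'a \<Rightarrow> ereal" where
  "indic S x = (if x \<in> S then 0 else \<infinity>)"

text \<open>\<Psi>(x,z,u,\<delta>,\<gamma>); gs is the conjugate g^*, h the smooth part\<close>
definition Psi :: "('n::real_inner \<Rightarrow> 's::real_inner) \<Rightarrow> ('s \<Rightarrow> ereal) \<Rightarrow> ('n \<Rightarrow> real) \<Rightarrow> 'n set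
     \<Rightarrow> 'n \<Rightarrow> 's \<Rightarrow> 'n \<Rightarrow> real \<Rightarrow> real \<Rightarrow> ereal" where
  "Psi A gs h S x z u \<delta> \<gamma> =
     ereal (z \<bullet> A x) - gs z + ereal (h x) + indic S x
     + ereal (\<delta> / 2 * (norm (x - u))\<^sup>2) - ereal (\<gamma> / 2 * (norm z)\<^sup>2)"

text \<open>\<Pi>(x,z,u) = \<Psi>(x,z,u,\<delta>,\<gamma>)/f(Kx) on R^n \<times> dom g^* \<times> R^n, extended by +\<infinity> outside
  (where \<Psi> = +\<infinity> anyway via \<iota>_S, or outside the stated domain).\<close>
definition PiF :: "('n::real_inner \<Rightarrow> 's::real_inner) \<Rightarrow> ('s \<Rightarrow> ereal) \<Rightarrow> ('n \<Rightarrow> real) \<Rightarrow> 'n set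
     \<Rightarrow> ('n \<Rightarrow> 'p) \<Rightarrow> ('p \<Rightarrow> ereal) \<Rightarrow> real \<Rightarrow> real \<Rightarrow> 'n \<times> 's \<times> 'n \<Rightarrow> ereal" where
  "PiF A gs h S K f \<delta> \<gamma> p = (case p of (x, z, u) \<Rightarrow>
     (if x \<in> S \<and> z \<in> edom gs then Psi A gs h S x z u \<delta> \<gamma> / f (K x) else \<infinity>))"

definition frechet_subdiff :: "('a::real_inner \<Rightarrow> ereal) \<Rightarrow> 'a \<Rightarrow> 'a set" where
  "frechet_subdiff F x = {v. \<bar>F x\<bar> \<noteq> \<infinity> \<and>
     (\<forall>e>0. \<exists>d>0. \<forall>y. norm (y - x) < d \<longrightarrow>
        F x + ereal (v \<bullet> (y - x) - e * norm (y - x)) \<le> F y)}"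

definition lim_subdiff :: "('a::real_inner \<Rightarrow> ereal) \<Rightarrow> 'a \<Rightarrow> 'a set" where
  "lim_subdiff F x = {v. \<bar>F x\<bar> \<noteq> \<infinity> \<and>
     (\<exists>xs vs. xs \<longlonglongrightarrow> x \<and> (\<lambda>k. F (xs k)) \<longlonglongrightarrow> F x \<and>
        (\<forall>k. vs k \<in> frechet_subdiff F (xs k)) \<and> vs \<longlonglongrightarrow> v)}"

end

theory Submission
  imports Defs
begin

text \<open>
  By Moreau's decomposition the proximal point \<open>z\<close> satisfies \<open>z \<in> \<partial>g(A x - \<gamma> z)\<close>. Essential strict
  convexity of \<open>g\<close> makes \<open>g\<^sup>*\<close> Frechet differentiable there with gradient \<open>A x - \<gamma> z\<close>, so \<open>\<Pi>\<close> is, near an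
  iterate, a differentiable quotient plus the indicator of \<open>S\<close>, with vanishing partial gradient in \<open>z\<close>.
  Adding to the gradient the normal vector to \<open>S\<close> supplied by the projection step cancels everything in
  the \<open>x\<close>-component except differences of consecutive iterates and of consecutive values \<open>\<theta>\<^sub>k\<close>. The
  latter are Lipschitz in the iterates since all sequences stay bounded and \<open>f(K x)\<close> stays above \<open>m\<close>.
\<close>

section \<open>Conjugates and proximal points\<close>

lemma econvexD:
  assumes "econvex F" "F a \<le> ereal r" "F b \<le> ereal s" "0 \<le> t" "t \<le> 1"
  shows "F ((1 - t) *\<^sub>R a + t *\<^sub>R b) \<le> ereal ((1 - t) * r + t * s)"
proof -
  have "(1 - t) *\<^sub>R (a, r) + t *\<^sub>R (b, s) \<in> {(x, r::real). F x \<le> ereal r}"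
    using assms by (intro convexD_alt) (auto simp: econvex_def)
  then show ?thesis by simp
qed

text \<open>The epigraph of the sum is the preimage of the epigraph of \<open>F\<close> under the
  continuous shear \<open>(w, r)\<close> to \<open>(w, r - c w)\<close>.\<close>

lemma elsc_add_continuous:
  assumes "elsc F" "continuous_on UNIV c"
  shows "elsc (\<lambda>w. F w + ereal (c w))"
proof -
  have "{(w, r::real). F w + ereal (c w) \<le> ereal r}
      = (\<lambda>(w, r). (w, r - c w)) -` {(w, r::real). F w \<le> ereal r}"
    by (auto simp: ereal_le_minus simp flip: ereal_minus(1))
  moreover have "continuous_on UNIV (\<lambda>(w, r). (w, r - c w))"
    unfolding case_prod_unfold
    by (intro continuous_intros continuous_on_compose2[OF assms(2)]) auto
  ultimately show ?thesis
    using closed_vimage[OF assms(1)[unfolded elsc_def]] unfolding elsc_def by (simp only:)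
qed

text \<open>Weierstrass: a minimising sequence has a subsequence converging in \<open>C\<close>, and
  closedness of the epigraph carries the bound to its limit.\<close>

lemma elsc_attains_inf:
  fixes F :: "'a::metric_space \<Rightarrow> ereal"
  assumes "elsc F" "compact C" "C \<noteq> {}"
  shows "\<exists>w\<in>C. \<forall>w'\<in>C. F w \<le> F w'"
proof -
  define i where "i = (INF w\<in>C. F w)"
  obtain W where W: "\<And>n. W n \<in> F ` C" "W \<longlonglongrightarrow> i"
    using Inf_as_limit[of "F ` C"] assms(3) unfolding i_def by auto
  then have "\<forall>n. \<exists>w. w \<in> C \<and> W n = F w" by blast
  then obtain w where w: "\<And>n. w n \<in> C" "\<And>n. W n = F (w n)"
    using choice_iff[of "\<lambda>n w. w \<in> C \<and> W n = F w"] by blast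
  obtain l r where l: "l \<in> C" "strict_mono r" "(w \<circ> r) \<longlonglongrightarrow> l"
    by (rule seq_compactE[OF compact_imp_seq_compact[OF assms(2)], of w]) (use w(1) in auto)
  have "F l \<le> i"
  proof (rule ccontr)
    assume "\<not> F l \<le> i"
    \<comment> \<open>The epigraph has only real heights, so a real \<open>s\<close> strictly above
      the possibly infinite \<open>i\<close> is used.\<close>
    then obtain s where s: "i < ereal s" "ereal s < F l"
      using ereal_dense2 by (metis not_le)
    have "(\<lambda>n. F (w (r n))) \<longlonglongrightarrow> i"
      using LIMSEQ_subseq_LIMSEQ[OF W(2) l(2)] w(2) by (simp add: o_def)
    then have "\<forall>\<^sub>F n in sequentially. F (w (r n)) < ereal s"
      using s(1) order_tendstoD(2) by blast
    then have "\<forall>\<^sub>F n in sequentially. (w (r n), s) \<in> {(x, r::real). F x \<le> ereal r}"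
      by eventually_elim auto
    moreover have "(\<lambda>n. (w (r n), s)) \<longlonglongrightarrow> (l, s)"
      using l(3) by (intro tendsto_Pair) (auto simp: o_def)
    ultimately have "(l, s) \<in> {(x, r::real). F x \<le> ereal r}"
      by (rule Lim_in_closed_set[OF assms(1)[unfolded elsc_def] _ sequentially_bot])
    then show False using s by simp
  qed
  then show ?thesis
    using l(1) by (auto simp: i_def le_INF_iff)
qed

lemma fenchel_young: "ereal (w \<bullet> v) - F w \<le> fconj F v"
  unfolding fconj_def by (rule SUP_upper) simp

lemma fconj_leI:
  assumes "\<And>w r. F w = ereal r \<Longrightarrow> w \<bullet> v - r \<le> c" "\<And>w. F w \<noteq> -\<infinity>"
  shows "fconj F v \<le> ereal c"
  unfolding fconj_def
proof (rule SUP_least)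
  fix w show "ereal (w \<bullet> v) - F w \<le> ereal c"
    using assms(1)[of w] assms(2)[of w] by (cases "F w") auto
qed

lemma fconj_gt_MInf:
  assumes "eproper F"
  shows "fconj F v \<noteq> -\<infinity>"
proof -
  obtain w where "F w \<noteq> \<infinity>" "F w \<noteq> -\<infinity>" using assms by (auto simp: eproper_def)
  then show ?thesis using fenchel_young[of w v F] by (cases "F w") auto
qed

text \<open>Equality case of Fenchel-Young: rearranged, the subgradient inequality says that
  \<open>w\<close> maximises the expression whose supremum is the conjugate.\<close>

lemma fconj_eq_csubdiff:
  assumes "v \<in> csubdiff F w"
  shows "fconj F v = ereal (w \<bullet> v) - F w"
proof (rule antisym)
  obtain a where a: "F w = ereal a" using assms by (cases "F w") (auto simp: csubdiff_def)
  have le: "ereal a + ereal (v \<bullet> (y - w)) \<le> F y" for y using assms a by (auto simp: csubdiff_def)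
  have "fconj F v \<le> ereal (w \<bullet> v - a)"
  proof (rule fconj_leI)
    fix y r assume "F y = ereal r"
    then show "y \<bullet> v - r \<le> w \<bullet> v - a"
      using le[of y] by (simp add: inner_diff_right inner_commute)
  next
    fix y show "F y \<noteq> -\<infinity>" using le[of y] by auto
  qed
  then show "fconj F v \<le> ereal (w \<bullet> v) - F w" by (simp add: a)
qed (rule fenchel_young)

text \<open>Fenchel-Young at the fixed point \<open>w\<close> is an affine minorant of the
  conjugate, and it is attained at \<open>v\<close>.\<close>

lemma csubdiff_fconj:
  assumes "v \<in> csubdiff F w"
  shows "w \<in> csubdiff (fconj F) v"
proof -
  obtain a where a: "F w = ereal a" using assms by (cases "F w") (auto simp: csubdiff_def)
  have "fconj F v + ereal (w \<bullet> (v' - v)) \<le> fconj F v'" for v'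
    using fenchel_young[of w v' F] fconj_eq_csubdiff[OF assms] a by (simp add: inner_diff_right)
  then show ?thesis
    using fconj_eq_csubdiff[OF assms] a by (auto simp: csubdiff_def)
qed

text \<open>If two points shared the subgradient \<open>v\<close>, then \<open>F\<close> would be affine with subgradient \<open>v\<close>
  along the segment between them.\<close>

lemma csubdiff_inj_of_ess_strictly_convex:
  assumes "econvex F" "ess_strictly_convex F" "v \<in> csubdiff F w" "v \<in> csubdiff F w'"
  shows "w = w'"
proof (rule ccontr)
  assume ne: "w \<noteq> w'"
  obtain a b where a: "F w = ereal a" and b: "F w' = ereal b"
    using assms(3,4) by (cases "F w"; cases "F w'") (auto simp: csubdiff_def)
  have le: "ereal (a + v \<bullet> (y - w)) \<le> F y" for y using assms(3) a by (auto simp: csubdiff_def)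
  have le': "ereal (b + v \<bullet> (y - w')) \<le> F y" for y using assms(4) b by (auto simp: csubdiff_def)
  \<comment> \<open>Each subgradient inequality is tested at the other point.\<close>
  have eq: "b = a + v \<bullet> (w' - w)"
    using le[of w'] le'[of w] a b by (simp add: inner_diff_right)
  have seg: "F ((1 - t) *\<^sub>R w + t *\<^sub>R w') = ereal ((1 - t) * a + t * b)" if "0 \<le> t" "t \<le> 1" for t
  proof (rule antisym)
    show "F ((1 - t) *\<^sub>R w + t *\<^sub>R w') \<le> ereal ((1 - t) * a + t * b)"
      using econvexD[OF assms(1)] a b that by simp
    have "a + v \<bullet> ((1 - t) *\<^sub>R w + t *\<^sub>R w' - w) = (1 - t) * a + t * b"
      unfolding eq by (simp add: inner_diff_right inner_add_right algebra_simps)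
    then show "ereal ((1 - t) * a + t * b) \<le> F ((1 - t) *\<^sub>R w + t *\<^sub>R w')"
      using le by metis
  qed
  have "v \<in> csubdiff F y" if y: "y \<in> closed_segment w w'" for y
  proof -
    obtain t where t: "0 \<le> t" "t \<le> 1" "y = (1 - t) *\<^sub>R w + t *\<^sub>R w'"
      using y unfolding closed_segment_def by blast
    have "(1 - t) * a + t * b + v \<bullet> (y' - y) = a + v \<bullet> (y' - w)" for y'
      unfolding eq t(3) by (simp add: inner_diff_right inner_add_right algebra_simps)
    then show ?thesis
      using le seg[OF t(1,2)] t(3) by (auto simp: csubdiff_def)
  qed
  then have "estrictly_convex_on F (closed_segment w w')"
    using assms(2) unfolding ess_strictly_convex_def by blast
  then have "F ((1 - 1/2) *\<^sub>R w + (1/2) *\<^sub>R w') < ereal (1 - 1/2) * F w + ereal (1/2) * F w'"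
    using ne unfolding estrictly_convex_on_def
    by (elim ballE[of _ _ w] ballE[of _ _ w'] allE[of _ "1/2"]) auto
  then show False
    using seg[of "1/2"] a b by simp
qed

text \<open>\<open>F - \<langle>v, \<cdot>\<rangle>\<close> has the unique minimiser \<open>w\<close>, so it grows at least linearly away from a small
  sphere around \<open>w\<close>. Perturbing \<open>v\<close> by less than the growth rate leaves only maximisers near \<open>w\<close>.\<close>

lemma fconj_frechet_upper:
  fixes F :: "'a::euclidean_space \<Rightarrow> ereal"
  assumes F: "econvex F" "elsc F" "ess_strictly_convex F" "v \<in> csubdiff F w" and e: "e > 0"
  shows "\<exists>d>0. \<forall>v'. norm (v' - v) < d \<longrightarrow>
           fconj F v' \<le> fconj F v + ereal (w \<bullet> (v' - v) + e * norm (v' - v))"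
proof -
  obtain a where a: "F w = ereal a" using F(4) by (cases "F w") (auto simp: csubdiff_def)
  have le: "ereal (a + v \<bullet> (y - w)) \<le> F y" for y using F(4) a by (auto simp: csubdiff_def)
  have "elsc (\<lambda>y. F y + ereal (- (v \<bullet> y)))"
    by (intro elsc_add_continuous F continuous_intros)
  moreover have "sphere w e \<noteq> {}" using e by simp
  \<comment> \<open>\<open>w1\<close> minimises the tilted function \<open>F - v\<close> on the
    sphere of radius \<open>e\<close>, where \<open>v\<close> can no longer be a
    subgradient.\<close>
  ultimately obtain w1 where w1: "w1 \<in> sphere w e"
      "\<And>y. y \<in> sphere w e \<Longrightarrow> F w1 + ereal (- (v \<bullet> w1)) \<le> F y + ereal (- (v \<bullet> y))"
    using elsc_attains_inf[OF _ compact_sphere] by blast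
  have "w1 \<noteq> w" using w1(1) e by auto
  then have "v \<notin> csubdiff F w1"
    using csubdiff_inj_of_ess_strictly_convex[OF F(1,3,4)] by blast
  have "F w1 \<noteq> ereal (a + v \<bullet> (w1 - w))"
  proof
    assume eq: "F w1 = ereal (a + v \<bullet> (w1 - w))"
    have "F w1 + ereal (v \<bullet> (y - w1)) \<le> F y" for y
      using le[of y] by (simp add: eq inner_diff_right)
    then show False using \<open>v \<notin> _\<close> eq by (auto simp: csubdiff_def)
  qed
  then have "ereal (a + v \<bullet> (w1 - w)) < F w1" using le[of w1] by simp
  \<comment> \<open>\<open>F w1\<close> may be infinite; the real \<open>s\<close> below it gives a
    finite gap \<open>c\<close> above the supporting affine function, valid on the whole
    sphere.\<close>
  then obtain s where s: "ereal (a + v \<bullet> (w1 - w)) < ereal s" "ereal s < F w1"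
    using ereal_dense2 by blast
  define c where "c = s - (a + v \<bullet> (w1 - w))"
  have c: "c > 0" using s(1) by (simp add: c_def)
  have sph: "a + v \<bullet> (y - w) + c \<le> r" if "y \<in> sphere w e" "F y \<le> ereal r" for y r
  proof -
    have "ereal (s - v \<bullet> w1) \<le> F w1 + ereal (- (v \<bullet> w1))"
      using s(2) by (cases "F w1") auto
    also have "\<dots> \<le> F y + ereal (- (v \<bullet> y))" using w1(2) that by simp
    also have "\<dots> \<le> ereal (r - v \<bullet> y)" using that(2) by (cases "F y") auto
    finally show ?thesis by (simp add: c_def inner_diff_right)
  qed
  \<comment> \<open>The segment from \<open>w\<close> to \<open>y\<close> meets the sphere at
    parameter \<open>t = e / norm (y - w)\<close>. Convexity along it turns the gap \<open>c\<close>
    into linear growth of slope \<open>c / e\<close>.\<close>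
  have far: "a + v \<bullet> (y - w) + c / e * norm (y - w) \<le> r" if "norm (y - w) \<ge> e" "F y = ereal r" for y r
  proof -
    define t where "t = e / norm (y - w)"
    have n: "norm (y - w) > 0" using that(1) e by linarith
    have t: "0 < t" "t \<le> 1" using that(1) e n by (auto simp: t_def)
    have d: "(1 - t) *\<^sub>R w + t *\<^sub>R y - w = t *\<^sub>R (y - w)" by (simp add: algebra_simps)
    have "norm ((1 - t) *\<^sub>R w + t *\<^sub>R y - w) = e"
      unfolding d using n e by (simp add: t_def)
    then have "a + v \<bullet> ((1 - t) *\<^sub>R w + t *\<^sub>R y - w) + c \<le> (1 - t) * a + t * r"
      using econvexD[OF F(1), of w a y r t] a that(2) t
      by (intro sph) (auto simp: dist_norm norm_minus_commute)
    then have "t * (a + v \<bullet> (y - w)) + c \<le> t * r"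
      unfolding d by (simp add: algebra_simps)
    moreover have "c = t * (c / e * norm (y - w))" using n e by (simp add: t_def)
    ultimately have "t * (a + v \<bullet> (y - w) + c / e * norm (y - w)) \<le> t * r"
      by (simp add: distrib_left)
    then show ?thesis using t by simp
  qed
  have cf: "fconj F v = ereal (w \<bullet> v - a)" using fconj_eq_csubdiff[OF F(4)] a by simp
  show ?thesis
  proof (intro exI conjI allI impI)
    \<comment> \<open>With a perturbation below the slope \<open>c / e\<close>, points outside the
      ball cannot raise the supremum; points inside it cost at most
      \<open>e * norm (v' - v)\<close>.\<close>
    show "c / e > 0" using c e by simp
    fix v' assume v': "norm (v' - v) < c / e"
    have "fconj F v' \<le> ereal (w \<bullet> v - a + (w \<bullet> (v' - v) + e * norm (v' - v)))"
    proof (rule fconj_leI)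
      fix y r assume r: "F y = ereal r"
      have cs: "(y - w) \<bullet> (v' - v) \<le> norm (y - w) * norm (v' - v)" by (rule norm_cauchy_schwarz)
      have id: "y \<bullet> v' = w \<bullet> v + w \<bullet> (v' - v) + v \<bullet> (y - w) + (y - w) \<bullet> (v' - v)"
        by (simp add: inner_diff_left inner_diff_right inner_commute)
      show "y \<bullet> v' - r \<le> w \<bullet> v - a + (w \<bullet> (v' - v) + e * norm (v' - v))"
      proof (cases "norm (y - w) \<ge> e")
        case True
        have "norm (y - w) * norm (v' - v) \<le> norm (y - w) * (c / e)"
          using v' by (intro mult_left_mono) auto
        then show ?thesis
          using far[OF True r] cs id mult_nonneg_nonneg[OF less_imp_le[OF e] norm_ge_zero[of "v' - v"]]
          by (simp add: mult.commute)
      next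
        case False
        then have "norm (y - w) * norm (v' - v) \<le> e * norm (v' - v)"
          by (intro mult_right_mono) auto
        then show ?thesis using le[of y] r cs id by simp
      qed
    qed (use le in \<open>metis MInfty_neq_ereal(1) ereal_infty_less_eq(2)\<close>)
    then show "fconj F v' \<le> fconj F v + ereal (w \<bullet> (v' - v) + e * norm (v' - v))"
      by (simp add: cf)
  qed
qed

text \<open>The upper estimate is \<open>fconj_frechet_upper\<close>; the lower one is the
  subgradient inequality of the conjugate at \<open>v\<close>. Together they also make the conjugate
  finite near \<open>v\<close>.\<close>

lemma gderiv_fconj:
  fixes F :: "'a::euclidean_space \<Rightarrow> ereal"
  assumes F: "econvex F" "elsc F" "ess_strictly_convex F" "v \<in> csubdiff F w"
  shows "GDERIV (\<lambda>v. real_of_ereal (fconj F v)) v :> w"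
  unfolding gderiv_def has_derivative_at_alt
proof (intro conjI allI impI)
  show "bounded_linear (\<lambda>h. h \<bullet> w)" by (rule bounded_linear_inner_left)
  fix e :: real assume "e > 0"
  then obtain d where d: "d > 0" "\<And>v'. norm (v' - v) < d \<Longrightarrow>
           fconj F v' \<le> fconj F v + ereal (w \<bullet> (v' - v) + e * norm (v' - v))"
    using fconj_frechet_upper[OF F] by blast
  have sub: "\<bar>fconj F v\<bar> \<noteq> \<infinity>" "\<And>v'. fconj F v + ereal (w \<bullet> (v' - v)) \<le> fconj F v'"
    using csubdiff_fconj[OF F(4)] by (auto simp: csubdiff_def)
  have "norm (real_of_ereal (fconj F v') - real_of_ereal (fconj F v) - (v' - v) \<bullet> w) \<le> e * norm (v' - v)"
    if "norm (v' - v) < d" for v'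
    using sub(1) sub(2)[of v'] d(2)[OF that]
    by (cases "fconj F v"; cases "fconj F v'") (auto simp: inner_commute)
  then show "\<exists>d>0. \<forall>v'. norm (v' - v) < d \<longrightarrow>
      norm (real_of_ereal (fconj F v') - real_of_ereal (fconj F v) - (v' - v) \<bullet> w) \<le> e * norm (v' - v)"
    using d(1) by blast
qed

text \<open>A minimiser \<open>w\<close> of \<open>F\<close> plus the quadratic
  \<open>norm (y - a)\<close> squared over \<open>2 * c\<close> exists, and its optimality condition
  says that \<open>p = (a - w) / c\<close> is a subgradient at \<open>w\<close>.\<close>

lemma moreau_decomposition_exists:
  fixes F :: "'a::euclidean_space \<Rightarrow> ereal"
  assumes F: "econvex F" "elsc F" "csubdiff F w0 \<noteq> {}" and c: "c > 0"
  shows "\<exists>p. p \<in> csubdiff F (a - c *\<^sub>R p)"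
proof -
  obtain v0 where v0: "v0 \<in> csubdiff F w0" using F(3) by blast
  obtain b where b: "F w0 = ereal b" using v0 by (cases "F w0") (auto simp: csubdiff_def)
  have le: "ereal (b + v0 \<bullet> (y - w0)) \<le> F y" for y using v0 b by (auto simp: csubdiff_def)
  define H where "H y = F y + ereal ((norm (y - a))\<^sup>2 / (2 * c))" for y
  have "elsc H" unfolding H_def using c by (intro elsc_add_continuous F continuous_intros) auto
  \<comment> \<open>Beyond distance \<open>R = 2 * c * norm v0 + 2 * norm (w0 - a)\<close> from
    \<open>w0\<close>, the quadratic outweighs the affine minorant given by \<open>v0\<close>, so
    the minimum over the ball is global.\<close>
  define R where "R = 2 * c * (norm v0 + norm (w0 - a) / c)"
  have R: "R \<ge> 0" using c by (simp add: R_def)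
  obtain w where w: "w \<in> cball w0 R" "\<And>y. y \<in> cball w0 R \<Longrightarrow> H w \<le> H y"
    using elsc_attains_inf[OF \<open>elsc H\<close>, of "cball w0 R"] R by auto
  have sq: "(norm (y + d - a))\<^sup>2 = (norm (y - a))\<^sup>2 + 2 * ((y - a) \<bullet> d) + (norm d)\<^sup>2" for y d
    using power2_norm_eq_inner[of "(y - a) + d"] 
    by (simp add: power2_norm_eq_inner inner_add_left inner_add_right inner_commute algebra_simps)
  have outside: "H w0 \<le> H y" if "y \<notin> cball w0 R" for y
  proof -
    define n where "n = norm (y - w0)"
    have n: "n > R" using that by (simp add: n_def dist_norm norm_minus_commute)
    have "2 * c * norm v0 + 2 * norm (w0 - a) = R" using c by (simp add: R_def field_simps)
    then have "(n - 2 * c * norm v0 - 2 * norm (w0 - a)) * n \<ge> 0"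
      using n R by (intro mult_nonneg_nonneg) auto
    moreover have "v0 \<bullet> (y - w0) \<ge> - (norm v0 * n)" "(w0 - a) \<bullet> (y - w0) \<ge> - (norm (w0 - a) * n)"
      using Cauchy_Schwarz_ineq2[of v0 "y - w0"] Cauchy_Schwarz_ineq2[of "w0 - a" "y - w0"]
      by (auto simp: n_def)
    moreover from this(1) have "2 * c * (v0 \<bullet> (y - w0)) \<ge> - (2 * c * (norm v0 * n))"
      using c by (metis mult_left_mono mult_minus_right mult_nonneg_nonneg less_imp_le zero_le_numeral)
    ultimately have "0 \<le> 2 * c * (v0 \<bullet> (y - w0)) + (2 * ((w0 - a) \<bullet> (y - w0)) + n\<^sup>2)"
      by (simp add: algebra_simps power2_eq_square)
    then have "0 \<le> 2 * c * (v0 \<bullet> (y - w0)) + (norm (y - a))\<^sup>2 - (norm (w0 - a))\<^sup>2"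
      using sq[of w0 "y - w0"] by (simp add: n_def)
    then have "0 \<le> (2 * c * (v0 \<bullet> (y - w0)) + (norm (y - a))\<^sup>2 - (norm (w0 - a))\<^sup>2) / (2 * c)"
      using c by simp
    then have "b + (norm (w0 - a))\<^sup>2 / (2 * c) \<le> b + v0 \<bullet> (y - w0) + (norm (y - a))\<^sup>2 / (2 * c)"
      using c by (simp add: add_divide_distrib diff_divide_distrib)
    then have "H w0 \<le> ereal (b + v0 \<bullet> (y - w0)) + ereal ((norm (y - a))\<^sup>2 / (2 * c))"
      by (simp add: H_def b)
    also have "\<dots> \<le> H y" unfolding H_def by (intro add_right_mono le)
    finally show ?thesis .
  qed
  have min: "H w \<le> H y" for y
    using outside[of y] w(2)[of y] w(2)[of w0] R by (cases "y \<in> cball w0 R") auto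
  have "F w \<noteq> -\<infinity>" "F w \<noteq> \<infinity>" using le[of w] min[of w0] b by (auto simp: H_def)
  then obtain s where s: "F w = ereal s" by (cases "F w") auto
  define p where "p = (1 / c) *\<^sub>R (a - w)"
  have "F w + ereal (p \<bullet> (y - w)) \<le> F y" for y
  proof (cases "F y")
    case (real r)
    define d where "d = y - w"
    \<comment> \<open>First-order optimality: minimality of \<open>w\<close> is tested at
      \<open>w + t d\<close>, convexity bounds \<open>F\<close> there, and division by
      \<open>t\<close> prepares the limit as \<open>t\<close> decreases to 0.\<close>
    have *: "s - r \<le> (1 / (2 * c)) * (2 * ((w - a) \<bullet> d) + t * (norm d)\<^sup>2)" if t: "0 < t" "t \<le> 1" for t
    proof -
      have wt: "(1 - t) *\<^sub>R w + t *\<^sub>R y = w + t *\<^sub>R d" by (simp add: d_def algebra_simps)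
      have "F (w + t *\<^sub>R d) \<le> ereal ((1 - t) * s + t * r)"
        using econvexD[OF F(1), of w s y r t] s real t wt by simp
      then have "H w \<le> ereal ((1 - t) * s + t * r) + ereal ((norm (w + t *\<^sub>R d - a))\<^sup>2 / (2 * c))"
        using min[of "w + t *\<^sub>R d"] unfolding H_def by (meson add_right_mono order_trans)
      then have "s + (norm (w - a))\<^sup>2 / (2 * c) \<le> (1 - t) * s + t * r + (norm (w + t *\<^sub>R d - a))\<^sup>2 / (2 * c)"
        by (simp add: H_def s)
      then have "t * (s - r) \<le> (2 * ((w - a) \<bullet> (t *\<^sub>R d)) + (norm (t *\<^sub>R d))\<^sup>2) / (2 * c)"
        unfolding sq add_divide_distrib by (simp add: algebra_simps)
      also have "\<dots> = t * ((1 / (2 * c)) * (2 * ((w - a) \<bullet> d) + t * (norm d)\<^sup>2))"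
        by (simp add: power_mult_distrib) (simp add: algebra_simps add_divide_distrib power2_eq_square)
      finally show ?thesis using t(1) mult_le_cancel_left_pos by blast
    qed
    have "((\<lambda>t. (1 / (2 * c)) * (2 * ((w - a) \<bullet> d) + t * (norm d)\<^sup>2))
        \<longlongrightarrow> (1 / (2 * c)) * (2 * ((w - a) \<bullet> d) + 0 * (norm d)\<^sup>2)) (at_right 0)"
      by (intro tendsto_intros)
    moreover have "\<forall>\<^sub>F t in at_right (0::real). s - r \<le> (1 / (2 * c)) * (2 * ((w - a) \<bullet> d) + t * (norm d)\<^sup>2)"
      using * by (auto simp: eventually_at_right_field intro!: exI[of _ 1])
    ultimately have "s - r \<le> (1 / (2 * c)) * (2 * ((w - a) \<bullet> d) + 0 * (norm d)\<^sup>2)"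
      by (rule tendsto_lowerbound) simp
    then have "s + p \<bullet> d \<le> r"
      using c by (simp add: p_def inner_diff_left field_simps)
    then show ?thesis by (simp add: s real d_def)
  qed (use le[of y] in auto)
  then have "p \<in> csubdiff F w" by (simp add: csubdiff_def s)
  moreover have "w = a - c *\<^sub>R p" using c by (simp add: p_def)
  ultimately show ?thesis by metis
qed

text \<open>Since \<open>prox\<close> is a definite description, existence and uniqueness of the
  minimiser must be shown. Strong convexity gives both for the point \<open>p0\<close> of the Moreau
  decomposition.\<close>

lemma prox_fconj_in_csubdiff:
  fixes F :: "'a::euclidean_space \<Rightarrow> ereal" and a :: 'a
  assumes F: "econvex F" "elsc F" "csubdiff F w0 \<noteq> {}" and c: "c > 0"
  defines "p \<equiv> prox (fconj F) (1 / c) ((1 / c) *\<^sub>R a)"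
  shows "p \<in> csubdiff F (a - c *\<^sub>R p)"
proof -
  obtain p0 where p0: "p0 \<in> csubdiff F (a - c *\<^sub>R p0)"
    using moreau_decomposition_exists[OF F c] by blast
  define H where "H w = fconj F w + ereal ((norm (w - (1 / c) *\<^sub>R a))\<^sup>2 / (2 * (1 / c)))" for w
  have sub: "\<bar>fconj F p0\<bar> \<noteq> \<infinity>" "\<And>v'. fconj F p0 + ereal ((a - c *\<^sub>R p0) \<bullet> (v' - p0)) \<le> fconj F v'"
    using csubdiff_fconj[OF p0] by (auto simp: csubdiff_def)
  \<comment> \<open>Expanding the square around \<open>p0\<close> leaves a linear term that cancels
    exactly against the subgradient \<open>a - c p0\<close> of the conjugate.\<close>
  have strong: "H p0 + ereal (c / 2 * (norm (w - p0))\<^sup>2) \<le> H w" for w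
  proof -
    have "w - (1 / c) *\<^sub>R a = (p0 - (1 / c) *\<^sub>R a) + (w - p0)" by simp
    then have "(norm (w - (1 / c) *\<^sub>R a))\<^sup>2 = (norm (p0 - (1 / c) *\<^sub>R a))\<^sup>2
        + 2 * ((p0 - (1 / c) *\<^sub>R a) \<bullet> (w - p0)) + (norm (w - p0))\<^sup>2"
      using dot_norm[of "p0 - (1 / c) *\<^sub>R a" "w - p0"] by simp
    then have "c / 2 * (norm (w - (1 / c) *\<^sub>R a))\<^sup>2 = c / 2 * (norm (p0 - (1 / c) *\<^sub>R a))\<^sup>2
        + c * ((p0 - (1 / c) *\<^sub>R a) \<bullet> (w - p0)) + c / 2 * (norm (w - p0))\<^sup>2"
      by (simp add: distrib_left)
    also have "c * ((p0 - (1 / c) *\<^sub>R a) \<bullet> (w - p0)) = - ((a - c *\<^sub>R p0) \<bullet> (w - p0))"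
      using c by (simp add: inner_diff_left right_diff_distrib)
    finally show ?thesis
      using sub(1) sub(2)[of w]
      by (cases "fconj F p0"; cases "fconj F w") (auto simp: H_def algebra_simps)
  qed
  have "p = p0"
    unfolding p_def prox_def
  proof (rule the_equality)
    have "H p0 \<le> H w" for w
    proof -
      have "H p0 \<le> H p0 + ereal (c / 2 * (norm (w - p0))\<^sup>2)"
        using c by (simp add: ereal_le_add_self)
      then show ?thesis using strong order_trans by blast
    qed
    then show "\<forall>w. fconj F p0 + ereal ((norm (p0 - (1 / c) *\<^sub>R a))\<^sup>2 / (2 * (1 / c)))
        \<le> fconj F w + ereal ((norm (w - (1 / c) *\<^sub>R a))\<^sup>2 / (2 * (1 / c)))"
      by (simp add: H_def)
    fix w assume "\<forall>w'. fconj F w + ereal ((norm (w - (1 / c) *\<^sub>R a))\<^sup>2 / (2 * (1 / c)))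
        \<le> fconj F w' + ereal ((norm (w' - (1 / c) *\<^sub>R a))\<^sup>2 / (2 * (1 / c)))"
    then have "H w \<le> H p0" by (simp add: H_def)
    then have "H p0 + ereal (c / 2 * (norm (w - p0))\<^sup>2) \<le> H p0" using strong order_trans by blast
    then have "c / 2 * (norm (w - p0))\<^sup>2 \<le> 0"
      using sub(1) by (cases "fconj F p0") (auto simp: H_def)
    then show "w = p0" using c by (simp add: mult_le_0_iff)
  qed
  then show ?thesis using p0 by simp
qed

section \<open>Subgradients of the quotient\<close>

text \<open>Each subgradient inequality is tested at the other point. This serves both the conjugate
  of \<open>g\<close> along the points \<open>z k\<close> and \<open>f\<close> along the points
  \<open>K (x k)\<close>.\<close>

lemma csubdiff_lipschitz:
  assumes "v \<in> csubdiff F a" "v' \<in> csubdiff F b" "norm v \<le> B" "norm v' \<le> B"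
  shows "\<bar>real_of_ereal (F a) - real_of_ereal (F b)\<bar> \<le> B * norm (a - b)"
proof -
  obtain r s where r: "F a = ereal r" and s: "F b = ereal s"
    using assms(1,2) by (cases "F a"; cases "F b") (auto simp: csubdiff_def)
  have "F a + ereal (v \<bullet> (b - a)) \<le> F b" "F b + ereal (v' \<bullet> (a - b)) \<le> F a"
    using assms(1,2) by (simp_all add: csubdiff_def)
  then have "r - s \<le> v \<bullet> (a - b)" "s - r \<le> v' \<bullet> (b - a)"
    by (simp_all add: r s inner_diff_right)
  moreover have "v \<bullet> (a - b) \<le> B * norm (a - b)"
    using norm_cauchy_schwarz[of v "a - b"] mult_right_mono[OF assms(3) norm_ge_zero[of "a - b"]] by linarith
  moreover have "v' \<bullet> (b - a) \<le> B * norm (a - b)"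
    using norm_cauchy_schwarz[of v' "b - a"] mult_right_mono[OF assms(4) norm_ge_zero[of "a - b"]]
    by (simp add: norm_minus_commute)
  ultimately show ?thesis by (simp add: r s)
qed

text \<open>The subgradient inequality makes \<open>a\<close> a local minimiser of \<open>F\<close>
  minus the linear form of \<open>v\<close>, so the derivative of the difference vanishes.
  Finiteness on \<open>U\<close> keeps \<open>real_of_ereal\<close> faithful.\<close>

lemma csubdiff_eq_gradient:
  fixes F :: "'a::real_inner \<Rightarrow> ereal"
  assumes v: "v \<in> csubdiff F a" and U: "open U" "a \<in> U" "\<And>w. w \<in> U \<Longrightarrow> F w < \<infinity>"
    and D: "GDERIV (\<lambda>w. real_of_ereal (F w)) a :> D"
  shows "v = D"
proof -
  obtain r where r: "F a = ereal r" using v by (cases "F a") (auto simp: csubdiff_def)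
  have le: "ereal (r + v \<bullet> (w - a)) \<le> F w" for w using v r by (auto simp: csubdiff_def)
  have "((\<lambda>w. real_of_ereal (F w) - v \<bullet> w) has_derivative (\<lambda>d. d \<bullet> D - v \<bullet> d)) (at a)"
    using D unfolding gderiv_def by (intro derivative_intros)
  moreover obtain e where e: "e > 0" "ball a e \<subseteq> U" using U(1,2) openE by blast
  moreover have "real_of_ereal (F a) - v \<bullet> a \<le> real_of_ereal (F w) - v \<bullet> w" if "w \<in> ball a e" for w
  proof -
    have "w \<in> U" using that e(2) by blast
    then show ?thesis
      using le[of w] U(3)[of w] r by (cases "F w") (auto simp: inner_diff_right)
  qed
  ultimately have "(\<lambda>d. d \<bullet> D - v \<bullet> d) = (\<lambda>d. 0)"
    by (intro differential_zero_maxmin[of a "ball a e"]) auto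
  \<comment> \<open>The zero derivative is evaluated in the direction \<open>D - v\<close>.\<close>
  then have "(D - v) \<bullet> D - v \<bullet> (D - v) = 0" by metis
  then have "(D - v) \<bullet> (D - v) = 0" by (simp add: inner_diff_left inner_diff_right inner_commute)
  then show ?thesis by simp
qed

lemma frechet_subdiff_subset_lim_subdiff: "frechet_subdiff F p \<subseteq> lim_subdiff F p"
proof
  fix v assume "v \<in> frechet_subdiff F p"
  then show "v \<in> lim_subdiff F p"
    unfolding lim_subdiff_def
    by (intro CollectI conjI, simp add: frechet_subdiff_def)
      (rule exI[of _ "\<lambda>_. p"], rule exI[of _ "\<lambda>_. v"], simp)
qed

text \<open>Where \<open>F\<close> is finite it equals \<open>Q\<close>, and the term with
  \<open>n\<close> only lowers the left-hand side of the subgradient inequality; elsewhere that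
  inequality is trivial.\<close>

lemma frechet_subdiff_gradient_plus_normal:
  fixes F :: "'a::real_inner \<Rightarrow> ereal"
  assumes D: "(Q has_derivative (\<lambda>d. v \<bullet> d)) (at p)" and Fp: "F p = ereal (Q p)"
    and F: "\<And>p'. F p' = \<infinity> \<or> F p' = ereal (Q p') \<and> n \<bullet> (p' - p) \<le> 0"
  shows "v + n \<in> frechet_subdiff F p"
proof -
  have "\<exists>d>0. \<forall>y. norm (y - p) < d \<longrightarrow> F p + ereal ((v + n) \<bullet> (y - p) - e * norm (y - p)) \<le> F y"
    if "e > 0" for e
  proof -
    obtain d where d: "d > 0"
      "\<And>y. norm (y - p) < d \<Longrightarrow> norm (Q y - Q p - v \<bullet> (y - p)) \<le> e * norm (y - p)"
      using D \<open>e > 0\<close> unfolding has_derivative_at_alt by blast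
    have "F p + ereal ((v + n) \<bullet> (y - p) - e * norm (y - p)) \<le> F y" if "norm (y - p) < d" for y
      using F[of y] d(2)[OF that] by (auto simp: Fp inner_add_left abs_le_iff)
    then show ?thesis using d(1) by blast
  qed
  then show ?thesis by (simp add: frechet_subdiff_def Fp)
qed

text \<open>Real-valued counterpart of \<open>Psi\<close> without the indicator, \<open>G\<close>
  standing for the conjugate. Squared norms appear as inner products so that the product rule
  differentiates them.\<close>

definition psi_real where
  "psi_real A G h x z u \<delta> \<gamma> = z \<bullet> A x - G z + h x + \<delta> / 2 * ((x - u) \<bullet> (x - u)) - \<gamma> / 2 * (z \<bullet> z)"

lemma Psi_eq_psi_real:
  assumes "x \<in> S" "\<bar>gs z\<bar> \<noteq> \<infinity>"
  shows "Psi A gs h S x z u \<delta> \<gamma> = ereal (psi_real A (\<lambda>z. real_of_ereal (gs z)) h x z u \<delta> \<gamma>)"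
  using assms by (cases "gs z") (auto simp: Psi_def psi_real_def indic_def power2_norm_eq_inner)

text \<open>The partial gradient in \<open>z\<close> is
  \<open>A x - (A x - \<gamma> z) - \<gamma> z\<close>, hence the 0 in the middle slot.\<close>

lemma psi_real_has_derivative:
  fixes A :: "'n::euclidean_space \<Rightarrow> 's::euclidean_space"
  assumes "linear A" and G: "GDERIV G z :> A x - \<gamma> *\<^sub>R z" and h: "GDERIV h x :> hx"
  shows "((\<lambda>(x, z, u). psi_real A G h x z u \<delta> \<gamma>) has_derivative
          (\<lambda>d. (adjoint A z + hx + \<delta> *\<^sub>R (x - u), 0, \<delta> *\<^sub>R (u - x)) \<bullet> d)) (at (x, z, u))"
proof -
  have bl: "bounded_linear A" using assms(1) by (simp add: linear_conv_bounded_linear)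
  \<comment> \<open>\<open>G\<close> and \<open>h\<close> have known derivatives at one point only,
    so their chain rules are instantiated at \<open>(x, z, u)\<close>.\<close>
  note [derivative_intros] =
    has_derivative_compose[OF has_derivative_fst[OF has_derivative_snd[OF has_derivative_ident]],
      of G _ "(x, z, u)", simplified, OF G[unfolded gderiv_def]]
    has_derivative_compose[OF has_derivative_fst[OF has_derivative_ident],
      of h _ "(x, z, u)", simplified, OF h[unfolded gderiv_def]]
    bounded_linear.has_derivative[OF bl]
  show ?thesis
    unfolding psi_real_def case_prod_unfold
    by (rule has_derivative_eq_rhs, (rule derivative_intros)+)
      (simp add: fun_eq_iff inner_prod_def adjoint_clauses[OF assms(1)] inner_add_left inner_add_right
        inner_diff_left inner_diff_right algebra_simps inner_commute)
qed

section \<open>Lipschitz and boundedness estimates\<close>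

lemma abs_inner_diff_le:
  fixes a b a' b' :: "'a::real_inner"
  shows "\<bar>a \<bullet> b - a' \<bullet> b'\<bar> \<le> norm a * norm (b - b') + norm (a - a') * norm b'"
proof -
  have "a \<bullet> b - a' \<bullet> b' = a \<bullet> (b - b') + (a - a') \<bullet> b'"
    by (simp add: inner_diff_left inner_diff_right)
  then show ?thesis
    using Cauchy_Schwarz_ineq2[of a "b - b'"] Cauchy_Schwarz_ineq2[of "a - a'" b'] by linarith
qed

text \<open>On a ball of radius \<open>R\<close> every bilinear term is Lipschitz by
  \<open>abs_inner_diff_le\<close>; \<open>G\<close> and \<open>h\<close> enter through their own
  constants \<open>W\<close> and \<open>H\<close>.\<close>

lemma psi_real_lipschitz:
  fixes A :: "'n::euclidean_space \<Rightarrow> 's::euclidean_space"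
  assumes A: "linear A" "\<And>v. norm (A v) \<le> B * norm v" "B \<ge> 0"
    and G: "\<bar>G z - G z'\<bar> \<le> W * norm (z - z')" "W \<ge> 0"
    and h: "\<bar>h x - h x'\<bar> \<le> H * norm (x - x')" "H \<ge> 0"
    and R: "norm x \<le> R" "norm x' \<le> R" "norm u \<le> R" "norm u' \<le> R" "norm z \<le> R" "norm z' \<le> R"
    and c: "\<delta> \<ge> 0" "\<gamma> \<ge> 0"
  shows "\<bar>psi_real A G h x z u \<delta> \<gamma> - psi_real A G h x' z' u' \<delta> \<gamma>\<bar>
    \<le> (R * B + W + H + 2 * R * \<delta> + R * \<gamma>) * (norm (x - x') + norm (u - u') + norm (z - z'))"
    (is "_ \<le> _ * (?x + ?u + ?z)")
proof -
  define s where "s = ?x + ?u + ?z"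
  have R0: "R \<ge> 0" using R(1) norm_ge_zero order_trans by blast
  have 1: "\<bar>z \<bullet> A x - z' \<bullet> A x'\<bar> \<le> R * B * ?x + R * B * ?z"
  proof -
    have "norm z * norm (A x - A x') \<le> R * (B * ?x)"
      using A(2)[of "x - x'"] R R0 by (intro mult_mono) (auto simp: linear_diff[OF A(1)])
    moreover have "?z * norm (A x') \<le> ?z * (B * R)"
      using A(2)[of x'] R A(3) by (intro mult_left_mono) (auto intro: order_trans mult_left_mono)
    ultimately show ?thesis
      using abs_inner_diff_le[of z "A x" z' "A x'"] by (simp add: algebra_simps)
  qed
  have 2: "\<bar>(x - u) \<bullet> (x - u) - (x' - u') \<bullet> (x' - u')\<bar> \<le> 4 * R * (?x + ?u)"
  proof -
    have d: "norm ((x - u) - (x' - u')) \<le> ?x + ?u"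
      using norm_triangle_ineq4[of "x - x'" "u - u'"] by (simp add: algebra_simps)
    have "norm (x - u) \<le> 2 * R" "norm (x' - u') \<le> 2 * R"
      using norm_triangle_ineq4[of x u] norm_triangle_ineq4[of x' u'] R by auto
    then have "norm (x - u) * norm ((x - u) - (x' - u')) \<le> 2 * R * (?x + ?u)"
      "norm ((x - u) - (x' - u')) * norm (x' - u') \<le> (?x + ?u) * (2 * R)"
      using d R0 by (intro mult_mono; simp)+
    then show ?thesis
      using abs_inner_diff_le[of "x - u" "x - u" "x' - u'" "x' - u'"] by (simp add: algebra_simps)
  qed
  have 3: "\<bar>z \<bullet> z - z' \<bullet> z'\<bar> \<le> 2 * R * ?z"
  proof -
    have "norm z * ?z \<le> R * ?z" "?z * norm z' \<le> ?z * R"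
      using R by (intro mult_right_mono mult_left_mono; simp)+
    then show ?thesis using abs_inner_diff_le[of z z z' z'] by (simp add: algebra_simps)
  qed
  have scaled: "\<bar>c / 2 * a - c / 2 * b\<bar> \<le> c / 2 * r" if "\<bar>a - b\<bar> \<le> r" "0 \<le> c" for a b c r :: real
  proof -
    have "\<bar>c / 2 * (a - b)\<bar> \<le> c / 2 * r"
      unfolding abs_mult using that by (intro mult_mono) auto
    then show ?thesis by (simp only: right_diff_distrib)
  qed
  have 2: "\<bar>\<delta> / 2 * ((x - u) \<bullet> (x - u)) - \<delta> / 2 * ((x' - u') \<bullet> (x' - u'))\<bar> \<le> 2 * R * \<delta> * (?x + ?u)"
    using scaled[OF 2 c(1)] by (simp add: algebra_simps)
  have 3: "\<bar>\<gamma> / 2 * (z \<bullet> z) - \<gamma> / 2 * (z' \<bullet> z')\<bar> \<le> R * \<gamma> * ?z"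
    using scaled[OF 3 c(2)] by (simp add: algebra_simps)
  have "\<bar>psi_real A G h x z u \<delta> \<gamma> - psi_real A G h x' z' u' \<delta> \<gamma>\<bar>
    \<le> R * B * (?x + ?z) + W * ?z + H * ?x + 2 * R * \<delta> * (?x + ?u) + R * \<gamma> * ?z"
    using 1 2 3 G(1) h(1) unfolding psi_real_def distrib_left by linarith
  also have "\<dots> \<le> R * B * s + W * s + H * s + 2 * R * \<delta> * s + R * \<gamma> * s"
    using A(3) G(2) h(2) c R0 by (intro add_mono mult_left_mono) (auto simp: s_def)
  finally show ?thesis by (simp add: distrib_right s_def)
qed

text \<open>Multiplied by \<open>D\<close>, the difference of quotients is
  \<open>(N - N') + N' / D' * (D' - D)\<close>, so a bound \<open>T\<close> on one quotient and a
  lower bound on the denominators suffice.\<close>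

lemma quotient_lipschitz:
  fixes N D N' D' :: real
  assumes "\<bar>N - N'\<bar> \<le> C1 * d" "\<bar>D - D'\<bar> \<le> C2 * d" "0 < m" "m \<le> D" "m \<le> D'" "\<bar>N' / D'\<bar> \<le> T"
    "0 \<le> d" "0 \<le> C2"
  shows "\<bar>N / D - N' / D'\<bar> \<le> (C1 + T * C2) / m * d"
proof -
  have "0 \<le> T" using assms(6) abs_ge_zero order_trans by blast
  then have "\<bar>N' / D' * (D' - D)\<bar> \<le> T * (C2 * d)"
    unfolding abs_mult using assms by (intro mult_mono) auto
  then have "\<bar>(N - N') + N' / D' * (D' - D)\<bar> \<le> (C1 + T * C2) * d"
    using assms(1) unfolding distrib_right mult.assoc by linarith
  moreover have "(N - N') + N' / D' * (D' - D) = (N / D - N' / D') * D"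
    using assms by (simp add: field_simps)
  ultimately have "\<bar>N / D - N' / D'\<bar> * D \<le> (C1 + T * C2) * d"
    using assms by (simp add: abs_mult)
  moreover have "\<bar>N / D - N' / D'\<bar> * m \<le> \<bar>N / D - N' / D'\<bar> * D"
    using assms by (intro mult_left_mono) auto
  ultimately show ?thesis using assms(3) by (simp add: field_simps)
qed

text \<open>As \<open>\<bar>1 - \<beta>\<bar> < 1\<close>, the recursion is a contraction with
  bounded forcing.\<close>

lemma averaged_sequence_bounded:
  fixes u x :: "nat \<Rightarrow> 'a::real_normed_vector"
  assumes \<beta>: "0 < \<beta>" "\<beta> < 2" and u: "\<And>k. u (Suc k) = (1 - \<beta>) *\<^sub>R u k + \<beta> *\<^sub>R x (Suc k)"
    and x: "\<And>k. norm (x (Suc k)) \<le> X"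
  shows "\<exists>B. \<forall>k. norm (u k) \<le> B"
proof -
  define r where "r = \<bar>1 - \<beta>\<bar>"
  have r: "r < 1" "0 \<le> r" using \<beta> by (auto simp: r_def)
  \<comment> \<open>The second entry is the fixed point of \<open>b = r * b + \<beta> * X\<close>,
    so the bound reproduces itself in the induction.\<close>
  define B where "B = max (norm (u 0)) (\<beta> * X / (1 - r))"
  have "norm (u k) \<le> B" for k
  proof (induction k)
    case (Suc k)
    have "norm (u (Suc k)) \<le> r * norm (u k) + \<beta> * norm (x (Suc k))"
      using norm_triangle_ineq[of "(1 - \<beta>) *\<^sub>R u k" "\<beta> *\<^sub>R x (Suc k)"] \<beta> by (simp add: u r_def)
    also have "\<dots> \<le> r * B + \<beta> * X"
      using Suc x \<beta> r by (intro add_mono mult_left_mono) auto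
    also have "\<beta> * X \<le> (1 - r) * B"
    proof -
      have "\<beta> * X = (1 - r) * (\<beta> * X / (1 - r))" using r by simp
      also have "\<dots> \<le> (1 - r) * B" using r by (intro mult_left_mono) (auto simp: B_def)
      finally show ?thesis .
    qed
    finally show ?case by (simp add: algebra_simps)
  qed (simp add: B_def)
  then show ?thesis by blast
qed

lemma lipschitz_gradient_bounded:
  assumes "bounded S" "\<And>v w. v \<in> S \<Longrightarrow> w \<in> S \<Longrightarrow> norm (G v - G w) \<le> L * norm (v - w)"
  shows "\<exists>B\<ge>0. \<forall>w\<in>S. norm (G w) \<le> B"
proof (cases "S = {}")
  case False
  then obtain w0 where w0: "w0 \<in> S" by blast
  obtain R where R: "\<And>w. w \<in> S \<Longrightarrow> norm w \<le> R" using assms(1) bounded_iff by metis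
  have "norm (G w) \<le> norm (G w0) + \<bar>L\<bar> * (2 * R)" if "w \<in> S" for w
  proof -
    \<comment> \<open>The sign of \<open>L\<close> is unknown, hence the absolute value.\<close>
    have "norm (w - w0) \<le> 2 * R" using norm_triangle_ineq4[of w w0] R[OF that] R[OF w0] by simp
    then have "L * norm (w - w0) \<le> \<bar>L\<bar> * (2 * R)" by (intro mult_mono) auto
    then show ?thesis
      using assms(2)[OF that w0] norm_triangle_sub[of "G w" "G w0"] by simp
  qed
  then show ?thesis
    using w0 norm_ge_zero order_trans by blast
qed auto

lemma bounded_gradient_lipschitz:
  fixes h :: "'a::real_inner \<Rightarrow> real"
  assumes "convex S" "\<And>w. w \<in> S \<Longrightarrow> GDERIV h w :> hg w" "\<And>w. w \<in> S \<Longrightarrow> norm (hg w) \<le> B"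
    "v \<in> S" "w \<in> S"
  shows "\<bar>h v - h w\<bar> \<le> B * norm (v - w)"
proof -
  have "norm (h v - h w) \<le> B * norm (v - w)"
  proof (rule differentiable_bound[OF assms(1) _ _ assms(4,5)])
    fix a assume a: "a \<in> S"
    show "(h has_derivative (\<lambda>d. d \<bullet> hg a)) (at a within S)"
      using assms(2)[OF a] unfolding gderiv_def by (rule has_derivative_at_withinI)
    show "onorm (\<lambda>d. d \<bullet> hg a) \<le> B"
    proof (rule onorm_bound)
      show "0 \<le> B" using assms(3)[OF a] norm_ge_zero order_trans by blast
      fix d
      have "norm (d \<bullet> hg a) \<le> norm (hg a) * norm d"
        using Cauchy_Schwarz_ineq2[of d "hg a"] by (simp add: mult.commute)
      also have "\<dots> \<le> B * norm d" using assms(3)[OF a] by (intro mult_right_mono) auto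
      finally show "norm (d \<bullet> hg a) \<le> B * norm d" .
    qed
  qed
  then show ?thesis by simp
qed

text \<open>The \<open>z\<close>-component of this subgradient vanishes because \<open>A x - \<gamma> z\<close> is the gradient of the
  conjugate at the proximal point \<open>z\<close>.\<close>

lemma PiF_frechet_subgradient:
  fixes A :: "'n::euclidean_space \<Rightarrow> 's::euclidean_space" and K :: "'n \<Rightarrow> 'p::euclidean_space"
    and u :: 'n and \<delta> :: real
  assumes lin: "linear A" "linear K"
    and gs: "\<And>z. gs z \<noteq> -\<infinity>" "gs z \<noteq> \<infinity>"
    and G: "GDERIV (\<lambda>z. real_of_ereal (gs z)) z :> A x - \<gamma> *\<^sub>R z"
    and h: "GDERIV h x :> hx"
    and f: "GDERIV (\<lambda>v. real_of_ereal (f v)) (K x) :> fx"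
    and fS: "\<And>w. w \<in> S \<Longrightarrow> 0 < f (K w) \<and> f (K w) < \<infinity>"
    and x: "x \<in> S" and n: "\<And>w. w \<in> S \<Longrightarrow> n \<bullet> (w - x) \<le> 0"
  defines "D \<equiv> real_of_ereal (f (K x))"
    and "N \<equiv> psi_real A (\<lambda>z. real_of_ereal (gs z)) h x z u \<delta> \<gamma>"
  shows "(1 / D) *\<^sub>R (adjoint A z + hx + \<delta> *\<^sub>R (x - u) - (N / D) *\<^sub>R adjoint K fx + n, 0, \<delta> *\<^sub>R (u - x))
           \<in> frechet_subdiff (PiF A gs h S K f \<delta> \<gamma>) (x, z, u)"
proof -
  define Q where "Q = (\<lambda>p. (case p of (x, z, u) \<Rightarrow> psi_real A (\<lambda>z. real_of_ereal (gs z)) h x z u \<delta> \<gamma>)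
      / real_of_ereal (f (K (fst p))))"
  define v where "v = (1 / D) *\<^sub>R (adjoint A z + hx + \<delta> *\<^sub>R (x - u) - (N / D) *\<^sub>R adjoint K fx, 0 :: 's, \<delta> *\<^sub>R (u - x))"
  have fin: "\<exists>r>0. f (K w) = ereal r" if "w \<in> S" for w
    using fS[OF that] by (cases "f (K w)") auto
  have D: "D > 0" using fin[OF x] by (auto simp: D_def)
  \<comment> \<open>Every finite value of \<open>PiF\<close> is a value of the quotient
    \<open>Q\<close>, which is the form needed for the gradient-plus-normal rule.\<close>
  have val: "PiF A gs h S K f \<delta> \<gamma> (x', z', u') = (if x' \<in> S \<and> gs z' \<noteq> \<infinity> then ereal (Q (x', z', u')) else \<infinity>)"
    for x' z' u'
  proof (cases "x' \<in> S \<and> gs z' \<noteq> \<infinity>")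
    case True
    then obtain r where "r > 0" "f (K x') = ereal r" using fin by blast
    then show ?thesis
      using True gs(1) Psi_eq_psi_real[of x' S gs z' A h u' \<delta> \<gamma>]
      by (cases "gs z'") (auto simp: PiF_def Q_def edom_def)
  qed (auto simp: PiF_def edom_def)
  have "((\<lambda>p. real_of_ereal (f (K (fst p)))) has_derivative (\<lambda>d. K (fst d) \<bullet> fx)) (at (x, z, u))"
    using has_derivative_compose[OF bounded_linear.has_derivative[OF lin(2)[unfolded linear_conv_bounded_linear]
        has_derivative_fst[OF has_derivative_ident]], of "\<lambda>v. real_of_ereal (f v)" _ "(x, z, u)"] f
    by (simp add: gderiv_def)
  moreover have quot: "((\<alpha>, 0 :: 's, \<mu>) \<bullet> d * D - N * (K (fst d) \<bullet> fx)) / (D * D)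
      = ((1 / D) *\<^sub>R (\<alpha> - (N / D) *\<^sub>R adjoint K fx, 0 :: 's, \<mu>)) \<bullet> d" for \<alpha> \<mu> :: 'n and d
  proof -
    have "K (fst d) \<bullet> fx = adjoint K fx \<bullet> fst d" by (simp add: adjoint_clauses[OF lin(2)] inner_commute)
    then show ?thesis using D by (cases d) (simp add: inner_prod_def inner_diff_left field_simps)
  qed
  ultimately have "(Q has_derivative (\<lambda>d. v \<bullet> d)) (at (x, z, u))"
    unfolding Q_def v_def quot[symmetric] using D
    by (intro has_derivative_eq_rhs[OF has_derivative_divide'[OF psi_real_has_derivative[OF lin(1) G h]]])
      (simp_all add: D_def N_def)
  \<comment> \<open>Normal vectors form a cone, so \<open>n\<close> may be scaled by
    \<open>1 / D > 0\<close> to share the factor of the gradient.\<close>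
  then have "v + ((1 / D) *\<^sub>R n, 0, 0) \<in> frechet_subdiff (PiF A gs h S K f \<delta> \<gamma>) (x, z, u)"
  proof (rule frechet_subdiff_gradient_plus_normal)
    show "PiF A gs h S K f \<delta> \<gamma> (x, z, u) = ereal (Q (x, z, u))" using val x gs(2) by simp
    fix p' :: "'n \<times> 's \<times> 'n"
    obtain x' z' u' where p': "p' = (x', z', u')" by (cases p')
    show "PiF A gs h S K f \<delta> \<gamma> p' = \<infinity> \<or> PiF A gs h S K f \<delta> \<gamma> p' = ereal (Q p') \<and>
        ((1 / D) *\<^sub>R n, 0, 0) \<bullet> (p' - (x, z, u)) \<le> 0"
      unfolding p' val using n[of x'] D by (auto simp: inner_prod_def divide_nonpos_pos)
  qed
  moreover have "v + ((1 / D) *\<^sub>R n, 0, 0) = (1 / D) *\<^sub>R (adjoint A z + hx + \<delta> *\<^sub>R (x - u)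
      - (N / D) *\<^sub>R adjoint K fx + n, 0, \<delta> *\<^sub>R (u - x))"
    by (simp add: v_def scaleR_add_right)
  ultimately show ?thesis by simp
qed

section \<open>Estimates along the iteration\<close>

theorem theorem6p4:
  fixes S :: "'n::euclidean_space set"
    and A :: "'n \<Rightarrow> 's::euclidean_space"
    and K :: "'n \<Rightarrow> 'p::euclidean_space"
    and g :: "'s \<Rightarrow> ereal" and f :: "'p \<Rightarrow> ereal"
    and h :: "'n \<Rightarrow> real" and hg :: "'n \<Rightarrow> 'n" and Lh :: real and ell :: real
    and \<beta> \<nu> q \<epsilon> :: real
    and x u :: "nat \<Rightarrow> 'n" and z :: "nat \<Rightarrow> 's" and y :: "nat \<Rightarrow> 'p"
    and \<theta> \<delta> \<gamma> :: "nat \<Rightarrow> real" and j :: "nat \<Rightarrow> nat"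
    and gm m M :: real and K0 K1 :: nat
  assumes S: "S \<noteq> {}" "convex S" "compact S"
    and lin: "linear A" "linear K"
    and g: "eproper g" "econvex g" "elsc g"
    and h: "\<exists>U. open U \<and> S \<subseteq> U \<and> (\<forall>w\<in>U. GDERIV h w :> hg w) \<and>
              (\<forall>v\<in>U. \<forall>w\<in>U. norm (hg v - hg w) \<le> Lh * norm (v - w))" "0 \<le> Lh"
    and f: "eproper f" "econvex f" "elsc f"
    and fdom: "K ` S \<subseteq> interior (edom f)"
    and fpos: "\<forall>w\<in>S. f (K w) > 0"
    and gdom: "S \<inter> A -` edom g \<noteq> {}"
    and infpos: "(INF w\<in>S. g (A w) + ereal (h w)) > 0"
    and subdg: "A ` S \<subseteq> {w. csubdiff g w \<noteq> {}}"
    and ell: "ell > 0" "\<forall>w\<in>S. infdist 0 (csubdiff g (A w)) \<le> ell"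
    \<comment> \<open>algorithm parameters\<close>
    and par: "0 < \<beta>" "\<beta> < 2" "\<nu> > 0" "0 < q" "q < 1" "\<delta> 0 > 0" "\<theta> 0 > 0" "\<gamma> 0 = 1" "\<epsilon> > 0"
    \<comment> \<open>algorithm iterations\<close>
    and it_y: "\<forall>k. y (Suc k) \<in> csubdiff f (K (x k))"
    and it_x: "\<forall>k. x (Suc k) = closest_point S (u k + (\<theta> k / \<delta> k) *\<^sub>R adjoint K (y (Suc k))
                   - (1 / \<delta> k) *\<^sub>R hg (x k) - (1 / \<delta> k) *\<^sub>R adjoint A (z k))"
    and it_u: "\<forall>k. u (Suc k) = (1 - \<beta>) *\<^sub>R u k + \<beta> *\<^sub>R x (Suc k)"
    and it_z: "\<forall>k. z (Suc k) = prox (fconj g) (1 / (\<gamma> k * q ^ j k))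
                                  ((1 / (\<gamma> k * q ^ j k)) *\<^sub>R A (x (Suc k)))"
    and it_theta: "\<forall>k. ereal (\<theta> (Suc k)) = Psi A (fconj g) h S (x (Suc k)) (z (Suc k)) (u (Suc k))
                                  (\<delta> k) (\<gamma> k * q ^ j k) / f (K (x (Suc k)))
                   \<and> \<theta> (Suc k) > 0"
    and it_jmin: "\<forall>k. \<forall>i < j k. \<not> (Psi A (fconj g) h S (x (Suc k))
                      (prox (fconj g) (1 / (\<gamma> k * q ^ i)) ((1 / (\<gamma> k * q ^ i)) *\<^sub>R A (x (Suc k))))
                      (u (Suc k)) (\<delta> k) (\<gamma> k * q ^ i) / f (K (x (Suc k))) > 0)"
    and it_gamma: "\<forall>k. \<gamma> (Suc k) =
                   (if norm (z (Suc k)) > min (\<epsilon> / (\<gamma> k * q ^ j k)) (sqrt (2 * \<epsilon> / (\<gamma> k * q ^ j k)))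
                    then \<gamma> k * q ^ j k * q else \<gamma> k * q ^ j k)"
    and it_delta: "\<forall>k. \<delta> (Suc k) = 2 * \<nu> + Lh + 2 * (onorm A)\<^sup>2 / \<gamma> (Suc k)"
    \<comment> \<open>hypotheses of the theorem\<close>
    and gm: "gm > 0"
    and stab: "\<forall>k\<ge>K0. \<gamma> k = gm \<and> \<delta> k = 2 * \<nu> + Lh + 2 * (onorm A)\<^sup>2 / gm \<and>
                      norm (z (Suc k)) \<le> min (\<epsilon> / gm) (sqrt (2 * \<epsilon> / gm))"
    and mM: "0 < m" "m \<le> M" "\<forall>k\<ge>1. ereal m < f (K (x k)) \<and> f (K (x k)) \<le> ereal M"
    and K1: "K1 \<ge> K0 + 1"
    and K1b: "\<forall>k\<ge>K1. ereal m \<le> ereal (K (x k) \<bullet> y k) - fconj f (y k) \<and>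
                      ereal (K (x k) \<bullet> y k) - fconj f (y k) \<le> f (K (x k)) \<and> f (K (x k)) \<le> ereal M"
    and fsmooth: "\<exists>U fg Lf. open U \<and> K ` S \<subseteq> U \<and> (\<forall>w\<in>U. f w < \<infinity>) \<and>
                   (\<forall>w\<in>U. GDERIV (\<lambda>v. real_of_ereal (f v)) w :> fg w) \<and>
                   (\<forall>v\<in>U. \<forall>w\<in>U. norm (fg v - fg w) \<le> Lf * norm (v - w))"
    and gesc: "ess_strictly_convex g"
  shows "\<exists>\<zeta>>0. \<forall>k\<ge>K1.
     lim_subdiff (PiF A (fconj g) h S K f (2 * \<nu> + Lh + 2 * (onorm A)\<^sup>2 / gm) gm)
                 (x (Suc k), z (Suc k), u (Suc k)) \<noteq> {} \<and>
     infdist 0 (lim_subdiff (PiF A (fconj g) h S K f (2 * \<nu> + Lh + 2 * (onorm A)\<^sup>2 / gm) gm)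
                 (x (Suc k), z (Suc k), u (Suc k)))
       \<le> \<zeta> * (norm (x k - x (Suc k)) + norm (u k - u (Suc k)) + norm (z k - z (Suc k)))"
proof -

  \<comment> \<open>Identities for the stabilised iterates\<close>
  obtain Uh where Uh: "open Uh" "S \<subseteq> Uh" "\<And>w. w \<in> Uh \<Longrightarrow> GDERIV h w :> hg w"
      "\<And>v w. v \<in> Uh \<Longrightarrow> w \<in> Uh \<Longrightarrow> norm (hg v - hg w) \<le> Lh * norm (v - w)"
    using h(1) by blast
  obtain Uf fg Lf where Uf: "open Uf" "K ` S \<subseteq> Uf" "\<And>w. w \<in> Uf \<Longrightarrow> f w < \<infinity>"
      "\<And>w. w \<in> Uf \<Longrightarrow> GDERIV (\<lambda>v. real_of_ereal (f v)) w :> fg w"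
      "\<And>v w. v \<in> Uf \<Longrightarrow> w \<in> Uf \<Longrightarrow> norm (fg v - fg w) \<le> Lf * norm (v - w)"
    using fsmooth by blast
  define \<delta>' where "\<delta>' = 2 * \<nu> + Lh + 2 * (onorm A)\<^sup>2 / gm"
  have \<delta>': "\<delta>' > 0" using par(3) h(2) gm by (simp add: \<delta>'_def add_pos_nonneg)
  define G where "G = (\<lambda>v. real_of_ereal (fconj g v))"
  define N where "N k = psi_real A G h (x k) (z k) (u k) \<delta>' gm" for k
  define D where "D k = real_of_ereal (f (K (x k)))" for k
  define \<Delta> where "\<Delta> k l = norm (x k - x l) + norm (u k - u l) + norm (z k - z l)" for k l
  have xS: "x (Suc k) \<in> S" for k
    using it_x closest_point_in_set compact_imp_closed[OF S(3)] S(1) by metis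
  \<comment> \<open>Iterate \<open>k\<close> is produced in step \<open>k - 1\<close>; since
    \<open>K1\<close> exceeds \<open>K0\<close>, that step already uses the stable
    parameters.\<close>
  have pred: "\<exists>i. k = Suc i \<and> i \<ge> K0" if "k \<ge> K1" for k
    using that K1 by (cases k) auto
  have xS': "x k \<in> S" if "k \<ge> K1" for k
    using xS[of "k - 1"] that K1 by simp
  have fS: "0 < f (K w) \<and> f (K w) < \<infinity>" if "w \<in> S" for w
    using that fpos Uf(2,3) by auto
  \<comment> \<open>Otherwise the extra reduction would have taken place, giving
    \<open>gm * q ^ Suc (j k) = gm\<close>, which is impossible for
    \<open>0 < q < 1\<close>.\<close>
  have step: "\<gamma> k * q ^ j k = gm" if "k \<ge> K0" for k
  proof (rule ccontr)
    assume "\<gamma> k * q ^ j k \<noteq> gm"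
    moreover have "\<gamma> k = gm" "\<gamma> (Suc k) = gm" using stab that by auto
    ultimately have "gm * q ^ Suc (j k) = gm"
      using it_gamma[rule_format, of k] by (simp add: mult.commute split: if_splits)
    then have "q ^ Suc (j k) = 1" using gm by simp
    then show False using par(4,5) power_Suc_less_one[of q "j k"] by simp
  qed
  obtain w0 where w0: "csubdiff g w0 \<noteq> {}" using subdg S(1) by blast
  have z: "z k \<in> csubdiff g (A (x k) - gm *\<^sub>R z k)" if "k \<ge> K1" for k
  proof -
    obtain i where i: "k = Suc i" "i \<ge> K0" using pred[OF \<open>k \<ge> K1\<close>] by blast
    then show ?thesis
      using it_z[rule_format, of i] step[of i] prox_fconj_in_csubdiff[OF g(2,3) w0 gm, of "A (x k)"] by simp
  qed
  have zs: "A (x k) - gm *\<^sub>R z k \<in> csubdiff (fconj g) (z k)" if "k \<ge> K1" for k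
    by (rule csubdiff_fconj[OF z[OF that]])
  then have gfin: "\<bar>fconj g (z k)\<bar> \<noteq> \<infinity>" if "k \<ge> K1" for k
    using that by (auto simp: csubdiff_def)
  \<comment> \<open>\<open>\<theta> k\<close> is computed with the value of \<open>\<delta>\<close>
    from step \<open>k - 1\<close>, which equals \<open>\<delta>'\<close> by stabilisation.\<close>
  have \<theta>: "\<theta> k = N k / D k" if "k \<ge> K1" for k
  proof -
    obtain i where i: "k = Suc i" "i \<ge> K0" using pred[OF \<open>k \<ge> K1\<close>] by blast
    have "\<delta> i = \<delta>'" using stab i by (simp add: \<delta>'_def)
    then have "ereal (\<theta> k) = ereal (N k) / f (K (x k))"
      using it_theta[rule_format, of i] step[of i] Psi_eq_psi_real[of "x k" S "fconj g" "z k"] xS'[OF that] gfin[OF that] i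
      by (simp add: N_def G_def)
    then show ?thesis
      using fS[OF xS'[OF that]] by (cases "f (K (x k))") (auto simp: D_def)
  qed
  \<comment> \<open>Differentiability of \<open>f\<close> leaves only one subgradient; the index
    shift reflects that \<open>y (Suc k)\<close> is chosen at \<open>x k\<close>.\<close>
  have y: "y (Suc k) = fg (K (x k))" if "k \<ge> K1" for k
    using csubdiff_eq_gradient[OF it_y[rule_format, of k] Uf(1) _ Uf(3) Uf(4)] Uf(2) xS'[OF that] by blast
  have D: "m \<le> D k" if "k \<ge> K1" for k
    using mM(3)[rule_format, of k] that K1 by (cases "f (K (x k))") (auto simp: D_def)

  \<comment> \<open>Uniform bounds on the iterates\<close>
  obtain BA where BA: "BA > 0" "\<And>v. norm (A v) \<le> BA * norm v"
    using linear_bounded_pos[OF lin(1)] by blast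
  obtain BK where BK: "BK > 0" "\<And>v. norm (K v) \<le> BK * norm v"
    using linear_bounded_pos[OF lin(2)] by blast
  obtain CA where CA: "CA > 0" "\<And>v. norm (adjoint A v) \<le> CA * norm v"
    using linear_bounded_pos[OF adjoint_linear[OF lin(1)]] by blast
  obtain CK where CK: "CK > 0" "\<And>v. norm (adjoint K v) \<le> CK * norm v"
    using linear_bounded_pos[OF adjoint_linear[OF lin(2)]] by blast
  obtain X where X: "\<And>w. w \<in> S \<Longrightarrow> norm w \<le> X"
    using compact_imp_bounded[OF S(3)] bounded_iff by metis
  obtain B where B: "\<And>k. norm (u k) \<le> B"
    using averaged_sequence_bounded[of \<beta> u x X] par it_u xS X by metis
  \<comment> \<open>The three entries bound \<open>x\<close> by compactness of \<open>S\<close>,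
    \<open>u\<close> by the averaging recursion and \<open>z\<close> by the norm test of the
    algorithm.\<close>
  define R where "R = max X (max B (\<epsilon> / gm))"
  have R: "norm (x k) \<le> R" "norm (u k) \<le> R" "norm (z k) \<le> R" if "k \<ge> K1" for k
  proof -
    show "norm (x k) \<le> R" "norm (u k) \<le> R" using X[OF xS'[OF that]] B[of k] by (auto simp: R_def)
    obtain i where "k = Suc i" "i \<ge> K0" using pred[OF \<open>k \<ge> K1\<close>] by blast
    then have "norm (z k) \<le> \<epsilon> / gm" using stab by simp
    then show "norm (z k) \<le> R" by (simp add: R_def)
  qed
  have R0: "R \<ge> 0" using R(1)[OF order_refl] norm_ge_zero order_trans by blast
  obtain H where H: "H \<ge> 0" "\<And>w. w \<in> S \<Longrightarrow> norm (hg w) \<le> H"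
    using lipschitz_gradient_bounded[OF compact_imp_bounded[OF S(3)], of hg Lh] Uh(2,4) by blast
  have "bounded (K ` S)"
    by (rule bounded_linear_image[OF compact_imp_bounded[OF S(3)]])
      (use lin(2) in \<open>simp add: linear_conv_bounded_linear\<close>)
  then obtain Y where Y: "Y \<ge> 0" "\<And>w. w \<in> K ` S \<Longrightarrow> norm (fg w) \<le> Y"
    using lipschitz_gradient_bounded[of "K ` S" fg Lf] Uf(2,5) by blast
  have yY: "norm (y (Suc k)) \<le> Y" if "k \<ge> K1" for k
    using Y(2) y[OF that] xS'[OF that] by simp

  \<comment> \<open>Lipschitz estimates for numerator, denominator and quotient\<close>
  define W where "W = BA * R + gm * R"
  have W: "W \<ge> 0" using BA R0 gm by (simp add: W_def)
  \<comment> \<open>These are the subgradients of the conjugate at \<open>z k\<close>, so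
    \<open>W\<close> is a Lipschitz constant for \<open>G\<close> along the iterates.\<close>
  have wW: "norm (A (x k) - gm *\<^sub>R z k) \<le> W" if "k \<ge> K1" for k
  proof -
    have "norm (A (x k)) \<le> BA * R"
      using BA(2)[of "x k"] mult_left_mono[OF R(1)[OF that], of BA] BA(1) by linarith
    moreover have "norm (gm *\<^sub>R z k) \<le> gm * R" using R(3)[OF that] gm by simp
    ultimately show ?thesis
      using norm_triangle_ineq4[of "A (x k)" "gm *\<^sub>R z k"] by (simp add: W_def)
  qed
  define C1 where "C1 = R * BA + W + H + 2 * R * \<delta>' + R * gm"
  have C1: "C1 \<ge> 0" using R0 BA W H \<delta>' gm by (simp add: C1_def)
  have \<Delta>0: "\<Delta> k l \<ge> 0" for k l by (simp add: \<Delta>_def)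
  have NL: "\<bar>N k - N l\<bar> \<le> C1 * \<Delta> k l" if "k \<ge> K1" "l \<ge> K1" for k l
    unfolding N_def C1_def \<Delta>_def
  proof (rule psi_real_lipschitz[OF lin(1) BA(2)])
    show "\<bar>G (z k) - G (z l)\<bar> \<le> W * norm (z k - z l)"
      unfolding G_def using that by (intro csubdiff_lipschitz[OF zs zs wW wW])
    show "\<bar>h (x k) - h (x l)\<bar> \<le> H * norm (x k - x l)"
      using Uh(2,3) H(2) xS' that by (intro bounded_gradient_lipschitz[OF S(2)]) auto
  qed (use that R BA(1) W H(1) \<delta>' gm in auto)
  define C2 where "C2 = Y * BK"
  have C2: "C2 \<ge> 0" using Y BK by (simp add: C2_def)
  have xK: "norm (K (x k) - K (x l)) \<le> BK * \<Delta> k l" for k l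
  proof -
    have "norm (K (x k) - K (x l)) \<le> BK * norm (x k - x l)"
      using BK(2)[of "x k - x l"] by (simp add: linear_diff[OF lin(2)])
    also have "\<dots> \<le> BK * \<Delta> k l" using BK(1) by (intro mult_left_mono) (auto simp: \<Delta>_def)
    finally show ?thesis .
  qed
  have DL: "\<bar>D k - D l\<bar> \<le> C2 * \<Delta> k l" if "k \<ge> K1" "l \<ge> K1" for k l
  proof -
    have "\<bar>D k - D l\<bar> \<le> Y * norm (K (x k) - K (x l))"
      unfolding D_def using that it_y yY by (intro csubdiff_lipschitz[of "y (Suc k)" _ _ "y (Suc l)"]) auto
    also have "\<dots> \<le> Y * (BK * \<Delta> k l)" using xK Y(1) by (rule mult_left_mono)
    finally show ?thesis by (simp add: C2_def mult.assoc)
  qed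
  \<comment> \<open>All iterates from \<open>K1\<close> on are within distance \<open>6 * R\<close>
    of iterate \<open>K1\<close> in the sense of \<open>\<Delta>\<close>, which bounds
    \<open>N\<close>; dividing by \<open>m\<close> bounds \<open>\<theta>\<close>.\<close>
  define T where "T = (\<bar>N K1\<bar> + C1 * (6 * R)) / m"
  have T: "\<bar>N k / D k\<bar> \<le> T" if "k \<ge> K1" for k
  proof -
    have "\<Delta> k K1 \<le> 6 * R"
      using norm_triangle_ineq4[of "x k" "x K1"] norm_triangle_ineq4[of "u k" "u K1"]
        norm_triangle_ineq4[of "z k" "z K1"] R[OF that] R[OF order_refl]
      by (simp add: \<Delta>_def)
    then have "C1 * \<Delta> k K1 \<le> C1 * (6 * R)" using C1 by (rule mult_left_mono)
    then have "\<bar>N k\<bar> \<le> \<bar>N K1\<bar> + C1 * (6 * R)" using NL[OF that order_refl] by linarith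
    then show ?thesis
      unfolding T_def abs_divide using D[OF that] mM(1) by (intro frac_le) auto
  qed
  have T0: "T \<ge> 0" using T[OF order_refl] abs_ge_zero order_trans by blast
  define C3 where "C3 = (C1 + T * C2) / m"
  have C3: "C3 \<ge> 0" using C1 T0 C2 mM(1) by (simp add: C3_def)
  have \<theta>L: "\<bar>\<theta> k - \<theta> l\<bar> \<le> C3 * \<Delta> k l" if "k \<ge> K1" "l \<ge> K1" for k l
    unfolding \<theta>[OF that(1)] \<theta>[OF that(2)] C3_def
    by (rule quotient_lipschitz[OF NL[OF that] DL[OF that] mM(1) D[OF that(1)] D[OF that(2)] T[OF that(2)] \<Delta>0 C2])

  \<comment> \<open>A small subgradient at each iterate\<close>
  define r where "r = \<bar>1 - \<beta>\<bar> / \<beta>"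
  \<comment> \<open>The summands are the bounds for \<open>e1\<close> to \<open>e5\<close> and for
    the \<open>u\<close>-component \<open>vu\<close>, in this order.\<close>
  define C4 where "C4 = CA + Lh + \<delta>' + T * (CK * (\<bar>Lf\<bar> * BK)) + C3 * (CK * Y) + \<delta>' * r"
  define \<zeta> where "\<zeta> = 1 / m * C4"
  have "r \<ge> 0" using par by (simp add: r_def)
  then have "C4 > 0"
    unfolding C4_def using CA CK h(2) \<delta>' T0 BK Y(1) C3
    by (intro add_pos_nonneg add_pos_pos) auto
  then have \<zeta>0: "\<zeta> > 0" using mM(1) by (simp add: \<zeta>_def)
  define P where "P = PiF A (fconj g) h S K f \<delta>' gm"
  have "\<exists>v. v \<in> lim_subdiff P (x (Suc k), z (Suc k), u (Suc k)) \<and> norm v \<le> \<zeta> * \<Delta> k (Suc k)"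
    if k: "k \<ge> K1" for k
  proof -
    have k': "Suc k \<ge> K1" using k by simp
    define a where "a = u k + (\<theta> k / \<delta>') *\<^sub>R adjoint K (y (Suc k)) - (1 / \<delta>') *\<^sub>R hg (x k) - (1 / \<delta>') *\<^sub>R adjoint A (z k)"
    have "\<delta> k = \<delta>'" using stab k K1 by (simp add: \<delta>'_def)
    then have xa: "x (Suc k) = closest_point S a" using it_x by (simp add: a_def)
    \<comment> \<open>The residual of a projection onto a convex set is normal to the set at the
      projected point; the factor \<open>\<delta>'\<close> clears the denominators of
      \<open>a\<close>.\<close>
    define n where "n = \<delta>' *\<^sub>R (a - x (Suc k))"
    have n: "n \<bullet> (w - x (Suc k)) \<le> 0" if "w \<in> S" for w
      using closest_point_dot[OF S(2) compact_imp_closed[OF S(3)] that, of a] \<delta>'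
      by (simp add: n_def xa mult_nonneg_nonpos)
    have n_eq: "n = \<delta>' *\<^sub>R (u k - x (Suc k)) + \<theta> k *\<^sub>R adjoint K (y (Suc k)) - hg (x k) - adjoint A (z k)"
      using \<delta>' by (simp add: n_def a_def scaleR_diff_right scaleR_add_right)
    define vx where "vx = adjoint A (z (Suc k)) + hg (x (Suc k)) + \<delta>' *\<^sub>R (x (Suc k) - u (Suc k))
        - \<theta> (Suc k) *\<^sub>R adjoint K (fg (K (x (Suc k)))) + n"
    define vu where "vu = \<delta>' *\<^sub>R (u (Suc k) - x (Suc k))"
    define v where "v = (1 / D (Suc k)) *\<^sub>R (vx, 0 :: 's, vu)"
    have "v \<in> frechet_subdiff P (x (Suc k), z (Suc k), u (Suc k))"
      unfolding v_def vx_def vu_def P_def \<theta>[OF k'] N_def D_def G_def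
    proof (rule PiF_frechet_subgradient[OF lin])
      show "fconj g v \<noteq> -\<infinity>" for v by (rule fconj_gt_MInf[OF g(1)])
      show "fconj g (z (Suc k)) \<noteq> \<infinity>" using gfin[OF k'] by auto
      show "GDERIV (\<lambda>v. real_of_ereal (fconj g v)) (z (Suc k)) :> A (x (Suc k)) - gm *\<^sub>R z (Suc k)"
        by (rule gderiv_fconj[OF g(2,3) gesc z[OF k']])
      show "GDERIV h (x (Suc k)) :> hg (x (Suc k))" using Uh(2,3) xS by blast
      show "GDERIV (\<lambda>v. real_of_ereal (f v)) (K (x (Suc k))) :> fg (K (x (Suc k)))"
        using Uf(2,4) xS by blast
    qed (use fS xS n in auto)
    then have "v \<in> lim_subdiff P (x (Suc k), z (Suc k), u (Suc k))"
      using frechet_subdiff_subset_lim_subdiff by blast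
    moreover have "norm v \<le> \<zeta> * \<Delta> k (Suc k)"
    proof -
      let ?\<Delta> = "\<Delta> k (Suc k)"
      define e1 where "e1 = adjoint A (z (Suc k) - z k)"
      define e2 where "e2 = hg (x (Suc k)) - hg (x k)"
      define e3 where "e3 = \<delta>' *\<^sub>R (u k - u (Suc k))"
      define e4 where "e4 = \<theta> k *\<^sub>R adjoint K (y (Suc k) - y (Suc (Suc k)))"
      define e5 where "e5 = (\<theta> k - \<theta> (Suc k)) *\<^sub>R adjoint K (y (Suc (Suc k)))"
      \<comment> \<open>The terms \<open>\<delta>' x (Suc k)\<close> cancel, leaving a difference of
        consecutive \<open>u\<close>. The change of the product of \<open>\<theta>\<close> and the
        adjoint term is split into \<open>e4\<close> (change of \<open>y\<close>) and
        \<open>e5\<close> (change of \<open>\<theta>\<close>).\<close>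
      have vx: "vx = e1 + e2 + e3 + e4 + e5"
        unfolding vx_def n_eq e1_def e2_def e3_def e4_def e5_def y[OF k, symmetric] y[OF k', symmetric]
          linear_diff[OF adjoint_linear[OF lin(1)]] linear_diff[OF adjoint_linear[OF lin(2)]]
        by (simp add: algebra_simps)
      have dle: "norm (x k - x (Suc k)) \<le> ?\<Delta>" "norm (u k - u (Suc k)) \<le> ?\<Delta>" "norm (z k - z (Suc k)) \<le> ?\<Delta>"
        by (auto simp: \<Delta>_def)
      have e1: "norm e1 \<le> CA * ?\<Delta>"
        using CA(2)[of "z (Suc k) - z k"] mult_left_mono[OF dle(3) less_imp_le[OF CA(1)]]
        unfolding e1_def norm_minus_commute[of "z (Suc k)"] by linarith
      have e2: "norm e2 \<le> Lh * ?\<Delta>"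
      proof -
        have "norm e2 \<le> Lh * norm (x (Suc k) - x k)"
          unfolding e2_def using Uh(2) xS[of k] xS'[OF k] by (intro Uh(4)) auto
        then show ?thesis
          using mult_left_mono[OF dle(1) h(2)] unfolding norm_minus_commute[of "x (Suc k)"] by linarith
      qed
      have e3: "norm e3 \<le> \<delta>' * ?\<Delta>"
        using dle(2) \<delta>' by (simp add: e3_def)
      have e4: "norm e4 \<le> T * (CK * (\<bar>Lf\<bar> * BK)) * ?\<Delta>"
      proof -
        have "norm (y (Suc k) - y (Suc (Suc k))) \<le> Lf * norm (K (x k) - K (x (Suc k)))"
          unfolding y[OF k] y[OF k'] using Uf(2) xS[of k] xS'[OF k] by (intro Uf(5)) auto
        also have "\<dots> \<le> \<bar>Lf\<bar> * (BK * ?\<Delta>)" using xK by (intro mult_mono) auto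
        finally have "CK * norm (y (Suc k) - y (Suc (Suc k))) \<le> CK * (\<bar>Lf\<bar> * (BK * ?\<Delta>))"
          using CK(1) by (intro mult_left_mono) auto
        then have "norm (adjoint K (y (Suc k) - y (Suc (Suc k)))) \<le> CK * (\<bar>Lf\<bar> * (BK * ?\<Delta>))"
          using CK(2) order_trans by blast
        then have "norm e4 \<le> T * (CK * (\<bar>Lf\<bar> * (BK * ?\<Delta>)))"
          unfolding e4_def norm_scaleR using T[OF k] \<theta>[OF k] T0 by (intro mult_mono) auto
        then show ?thesis by (simp add: mult.assoc)
      qed
      have e5: "norm e5 \<le> C3 * (CK * Y) * ?\<Delta>"
      proof -
        have "norm (adjoint K (y (Suc (Suc k)))) \<le> CK * Y"
          using CK(2)[of "y (Suc (Suc k))"] mult_left_mono[OF yY[OF k'], of CK] CK(1) by linarith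
        then have "norm e5 \<le> (C3 * ?\<Delta>) * (CK * Y)"
          unfolding e5_def norm_scaleR using \<theta>L[OF k k'] C3 \<Delta>0 by (intro mult_mono) auto
        then show ?thesis by (simp add: mult_ac)
      qed
      have vu: "norm vu \<le> \<delta>' * r * ?\<Delta>"
      proof -
        \<comment> \<open>Solving the averaging step for \<open>u (Suc k) - x (Suc k)\<close>
          expresses it through consecutive \<open>u\<close>, with ratio \<open>r\<close> in
          norm.\<close>
        have "\<beta> *\<^sub>R (u (Suc k) - x (Suc k)) = (1 - \<beta>) *\<^sub>R (u k - u (Suc k))"
          by (simp add: it_u algebra_simps)
        then have "\<beta> * norm (u (Suc k) - x (Suc k)) = \<bar>1 - \<beta>\<bar> * norm (u k - u (Suc k))"
          using par(1) by (metis norm_scaleR abs_of_pos)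
        then have "norm (u (Suc k) - x (Suc k)) = r * norm (u k - u (Suc k))"
          using par(1) by (simp add: r_def field_simps)
        then show ?thesis
          using mult_left_mono[OF dle(2) \<open>r \<ge> 0\<close>] \<delta>' by (simp add: vu_def mult.assoc)
      qed
      have "norm vx \<le> norm e1 + norm e2 + norm e3 + norm e4 + norm e5"
        unfolding vx by (intro norm_triangle_le add_mono order_refl)
      moreover have "norm (vx, 0 :: 's, vu) \<le> norm vx + norm vu"
        using norm_Pair_le[of vx "(0 :: 's, vu)"] norm_Pair_le[of "0 :: 's" vu] by simp
      ultimately have "norm (vx, 0 :: 's, vu) \<le> C4 * ?\<Delta>"
        using e1 e2 e3 e4 e5 vu unfolding C4_def distrib_right by linarith
      then have "1 / D (Suc k) * norm (vx, 0 :: 's, vu) \<le> 1 / m * (C4 * ?\<Delta>)"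
        using D[OF k'] mM(1) by (intro mult_mono frac_le) auto
      moreover have "norm v = 1 / D (Suc k) * norm (vx, 0 :: 's, vu)"
        unfolding v_def norm_scaleR using D[OF k'] mM(1) by simp
      ultimately show ?thesis by (simp add: \<zeta>_def)
    qed
    ultimately show ?thesis by blast
  qed
  \<comment> \<open>\<open>infdist\<close> to the empty set is 0 by convention, so nonemptiness is
    recorded with the estimate; the one small subgradient proves both.\<close>
  then have "\<forall>k\<ge>K1. lim_subdiff P (x (Suc k), z (Suc k), u (Suc k)) \<noteq> {} \<and>
      infdist 0 (lim_subdiff P (x (Suc k), z (Suc k), u (Suc k))) \<le> \<zeta> * \<Delta> k (Suc k)"
    by (metis empty_iff infdist_le2 dist_0_norm)
  then show ?thesis
    using \<zeta>0 unfolding P_def \<Delta>_def \<delta>'_def by blast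
qed

end
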